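(* Let $n_T,n_R\ge1$ and consider the point-to-point flat fading $n_T\times n_R$ MIMO channel described in the context, with a fixed unitary $n_T\times n_T$ precoder $P_t=P$ for all $t$. Then there exists a coding rate $R_{0}<1$ such that for every coding rate $R_c$ with $R_0<R_c<1$ only the receive diversity is achieved, i.e. the outage SNR exponent is $$d_{\mathrm{out}}=\lim_{\gamma\to\infty}-\frac{\log P_{\mathrm{out}}(\gamma)}{\log\gamma}=n_R .$$
   Context: Channel: $H\in\mathbb{C}^{n_R\times n_T}$ has i.i.d. circularly symmetric complex Gaussian entries $\mathcal{CN}(0,1)$; $H$ is drawn once and stays constant for all channel uses of a codeword. It is known at the receiver and unknown at the transmitter. The received vector at a channel use is $$\tilde{\mathbf y}=\sqrt{\gamma}\,H\tilde{\mathbf x}+\tilde{\mathbf w},\qquad \tilde{\mathbf x}=P\mathbf z,$$ where $\gamma>0$ is the SNR, $\tilde{\mathbf w}\in\mathbb{C}^{n_R}$ has i.i.d. $\mathcal{CN}(0,1)$ entries, and $P$ is a deterministic $n_T\times n_T$ unitary matrix that is the same at every channel use. Input: $M=2^q$ with $q\ge1$ a fixed integer (not depending on $\gamma$). The vector $\mathbf z\in\mathbb{C}^{n_T}$ has its first $\min(n_T,n_R)$ components independent and uniformly distributed on an $M$-QAM constellation (a fixed set of $M$ distinct complex points), and its last $n_T-\min(n_T,n_R)$ components equal to zero. The constellation is scaled so that its mean square magnitude is $1$ if $n_R\ge n_T$ and $n_T/n_R$ if $n_R<n_T$. Put $m=\min(n_T,n_R)\log_2 M$ (coded bits per channel use)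 and $R=mR_c$ (spectral efficiency), where $R_c$ is the coding rate. Let $I(\tilde{\mathbf x};\tilde{\mathbf y}\mid H)$ denote the mutual information in bits between input and output for the given realization of $H$, when $\tilde{\mathbf x}=P\mathbf z$ and the first $\min(n_T,n_R)$ components of $\mathbf z$ are independent and uniformly distributed on the $M$-QAM constellation, the remaining components being zero. The outage probability is $P_{\mathrm{out}}(\gamma)=\Pr\left(I(\tilde{\mathbf x};\tilde{\mathbf y}\mid H)<R\right)$. *)

theory Defs
  imports "HOL-Probability.Probability"
begin

text \<open>
  Density, with respect to the Lebesgue measure on the complex plane, of the circularly symmetric
  complex Gaussian law of mean \<open>0\<close> and \<open>E |X|^2 = 1\<close>, that is, with independent real and
  imaginary parts of variance \<open>1/2\<close>.
\<close>

definition complex_normal_density :: "complex \<Rightarrow> real" where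
  "complex_normal_density z = exp (- (cmod z)\<^sup>2) / pi"

definition unitary_matrix :: "complex^'n^'n \<Rightarrow> bool" where
  "unitary_matrix P \<longleftrightarrow>
     (let Q = (\<chi> i j. cnj (P $ j $ i)) in P ** Q = mat 1 \<and> Q ** P = mat 1)"

definition first_indices :: "nat \<Rightarrow> ('n :: {finite, linorder}) set" where
  "first_indices k = {j. card {i. i < j} < k}"

text \<open>
  The transmit antennas are indexed by \<open>'t\<close> (so \<open>n_T\<close> is \<open>CARD('t)\<close>) and the receive antennas by
  \<open>'r\<close> (so \<open>n_R\<close> is \<open>CARD('r)\<close>); the order on \<open>'t\<close> only serves to speak about the first components
  of a vector. Mutual independence of \<open>H\<close>, \<open>z\<close>, \<open>w\<close> is stated through their joint law, because
  \<open>indep_var\<close> requires values of the same type.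
\<close>

locale mimo_channel = prob_space \<Omega> for \<Omega> :: "'a measure" +
  fixes C :: "complex set"
    and H :: "'a \<Rightarrow> complex^('t :: {finite, linorder})^('r :: finite)"
    and z :: "'a \<Rightarrow> complex^('t :: {finite, linorder})"
    and w :: "'a \<Rightarrow> complex^'r"
  assumes channel_indep: "indep_vars (\<lambda>_. borel) (\<lambda>(i, j) \<omega>. H \<omega> $ i $ j) UNIV"
    and channel_distr: "\<And>i j. distributed \<Omega> lborel (\<lambda>\<omega>. H \<omega> $ i $ j)
         (\<lambda>c. ennreal (complex_normal_density c))"
    and input_indep:
      "indep_vars (\<lambda>_. count_space C) (\<lambda>j \<omega>. z \<omega> $ j) (first_indices (min CARD('t) CARD('r)))"
    and input_uniform:
      "\<And>j. j \<in> first_indices (min CARD('t) CARD('r)) \<Longrightarrow>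
         distributed \<Omega> (count_space C) (\<lambda>\<omega>. z \<omega> $ j) (\<lambda>_. ennreal (1 / real (card C)))"
    and input_zero:
      "\<And>j \<omega>. j \<notin> first_indices (min CARD('t) CARD('r)) \<Longrightarrow> \<omega> \<in> space \<Omega> \<Longrightarrow> z \<omega> $ j = 0"
    and noise_indep: "indep_vars (\<lambda>_. borel) (\<lambda>i \<omega>. w \<omega> $ i) UNIV"
    and noise_distr: "\<And>i. distributed \<Omega> lborel (\<lambda>\<omega>. w \<omega> $ i)
         (\<lambda>c. ennreal (complex_normal_density c))"
    and channel_input_noise_indep:
      "distr \<Omega> (borel \<Otimes>\<^sub>M (borel \<Otimes>\<^sub>M borel)) (\<lambda>\<omega>. (H \<omega>, z \<omega>, w \<omega>)) =
         distr \<Omega> borel H \<Otimes>\<^sub>M (distr \<Omega> borel z \<Otimes>\<^sub>M distr \<Omega> borel w)"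

definition received ::
    "real \<Rightarrow> complex^'t^'r \<Rightarrow> complex^'t \<Rightarrow> complex^'r \<Rightarrow> complex^'r" where
  "received \<gamma> h x w = sqrt \<gamma> *\<^sub>R (h *v x) + w"

text \<open>
  Mutual information in bits between channel input and output when the channel matrix takes the
  value \<open>h\<close>. As the channel matrix is independent of input and noise, conditioning on its
  value amounts to replacing it by the constant \<open>h\<close>.
\<close>

definition realization_mutual_information ::
    "'a measure \<Rightarrow> complex^'t^'t \<Rightarrow> ('a \<Rightarrow> complex^'t) \<Rightarrow> ('a \<Rightarrow> complex^'r) \<Rightarrow>
       real \<Rightarrow> complex^'t^'r \<Rightarrow> real" where
  "realization_mutual_information \<Omega> P z w \<gamma> h =
     prob_space.mutual_information \<Omega> 2 borel borel
       (\<lambda>\<omega>. P *v z \<omega>) (\<lambda>\<omega>. received \<gamma> h (P *v z \<omega>) (w \<omega>))"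

definition outage_probability ::
    "'a measure \<Rightarrow> complex^'t^'t \<Rightarrow> ('a \<Rightarrow> complex^'t^'r) \<Rightarrow> ('a \<Rightarrow> complex^'t) \<Rightarrow>
       ('a \<Rightarrow> complex^'r) \<Rightarrow> real \<Rightarrow> real \<Rightarrow> real" where
  "outage_probability \<Omega> P H z w R \<gamma> =
     measure \<Omega> {\<omega> \<in> space \<Omega>. realization_mutual_information \<Omega> P z w \<gamma> (H \<omega>) < R}"

end

theory Submission
  imports Defs "HOL-Real_Asymp.Real_Asymp"
begin

text \<open>
  Let \<open>N = M\<^sup>m\<close> be the number of signals and \<open>a\<^sub>x = sqrt \<gamma> h x\<close> the noiseless outputs. For a channel
  realization \<open>h\<close> the mutual information is \<open>log N\<close> minus the equivocation of a uniform mixture of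
  Gaussians centred at the \<open>a\<^sub>x\<close>. The equivocation is at least a constant \<open>g > 0\<close>, independent of
  \<open>\<gamma>\<close> and \<open>h\<close>, as soon as two centres are within distance 1 of each other; and it is at most
  \<open>2 N exp (- A\<^sup>2 / 4)\<close> if all centres are at distance at least \<open>A\<close> (Bhattacharyya bound). Hence
  for rates above \<open>1 - g / ln N\<close> outage is implied by \<open>\<parallel>h v\<parallel> \<le> 1 / sqrt \<gamma>\<close> for one fixed difference
  \<open>v \<noteq> 0\<close> of signals, and it implies \<open>\<parallel>h v\<parallel> < A / sqrt \<gamma>\<close> for one of finitely many such
  differences. The entries of \<open>h v\<close> are \<open>n\<^sub>R\<close> independent complex variables with bounded density that
  is positive near 0, so both events have probability of exact order \<open>\<gamma>\<close> to the power \<open>- n\<^sub>R\<close>.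
\<close>

section \<open>Densities of random vectors\<close>

lemma borel_measurable_vecI:
  fixes f :: "'a \<Rightarrow> 'b::euclidean_space^'n"
  assumes "\<And>i. (\<lambda>x. f x $ i) \<in> borel_measurable M"
  shows "f \<in> borel_measurable M"
  by (subst borel_measurable_euclidean_space)
     (use assms in \<open>auto simp: Basis_vec_def inner_axis intro!: borel_measurable_inner\<close>)

text \<open>Lebesgue measure is determined by the volumes of boxes, and a box of vectors is the
  product of the boxes of its components. This is the bridge from product measures on functions to
  measures on the vector type.\<close>

lemma lborel_vec_eq_distr_PiM:
  "(lborel :: ('a::euclidean_space^'n) measure) =
     distr (\<Pi>\<^sub>M i\<in>(UNIV::'n set). lborel) borel (\<lambda>f. \<chi> i. f i)"
proof (rule lborel_eqI)
  interpret product_sigma_finite "\<lambda>_::'n. lborel :: 'a measure" ..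
  have [measurable]: "(\<lambda>f. \<chi> i. f i) \<in> (\<Pi>\<^sub>M i\<in>(UNIV::'n set). (lborel::'a measure)) \<rightarrow>\<^sub>M borel"
    by (rule borel_measurable_vecI) simp
  fix l u :: "'a^'n"
  assume le: "\<And>b. b \<in> Basis \<Longrightarrow> l \<bullet> b \<le> u \<bullet> b"
  have le': "l $ i \<bullet> b \<le> u $ i \<bullet> b" if "b \<in> Basis" for i b
    using le[of "axis i b"] that by (auto simp: inner_axis Basis_vec_def)
  have "(\<lambda>f. \<chi> i. f i) -` box l u \<inter> space (\<Pi>\<^sub>M i\<in>(UNIV::'n set). (lborel::'a measure)) =
      (\<Pi>\<^sub>E i\<in>UNIV. box (l $ i) (u $ i))"
    by (auto simp: box_def Basis_vec_def inner_axis space_PiM PiE_def extensional_def)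
  then have "emeasure (distr (\<Pi>\<^sub>M i\<in>(UNIV::'n set). lborel) borel (\<lambda>f. \<chi> i. f i)) (box l u) =
      (\<Prod>i\<in>UNIV. emeasure lborel (box (l $ i) (u $ i)))"
    by (simp add: emeasure_distr emeasure_PiM)
  also have "\<dots> = (\<Prod>i\<in>UNIV. ennreal (\<Prod>b\<in>Basis. (u $ i - l $ i) \<bullet> b))"
    using le' by (intro prod.cong refl) (simp add: emeasure_lborel_box_eq)
  also have "\<dots> = ennreal (\<Prod>i\<in>UNIV. \<Prod>b\<in>Basis. (u $ i - l $ i) \<bullet> b)"
    using le' by (intro prod_ennreal prod_nonneg) (auto simp: inner_diff_left)
  also have "(\<Prod>i\<in>UNIV. \<Prod>b\<in>Basis. (u $ i - l $ i) \<bullet> b) = (\<Prod>b\<in>Basis. (u - l) \<bullet> b)"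
  proof -
    have "(Basis :: ('a^'n) set) = (\<lambda>(i, b). axis i b) ` (UNIV \<times> Basis)"
      by (auto simp: Basis_vec_def)
    moreover have "inj_on (\<lambda>(i::'n, b::'a). axis i b) (UNIV \<times> Basis)"
      by (auto simp: inj_on_def axis_eq_axis)
    ultimately have "(\<Prod>b\<in>Basis. (u - l) \<bullet> b) = (\<Prod>(i, b)\<in>UNIV \<times> Basis. (u - l) \<bullet> axis i b)"
      by (metis (mono_tags, lifting) prod.reindex_cong case_prod_unfold)
    then show ?thesis
      by (simp add: prod.cartesian_product inner_axis)
  qed
  finally show "emeasure (distr (\<Pi>\<^sub>M i\<in>(UNIV::'n set). lborel) borel (\<lambda>f. \<chi> i. f i)) (box l u) =
    ennreal (\<Prod>b\<in>Basis. (u - l) \<bullet> b)" .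
qed simp

text \<open>By Tonelli both measures give the same mass to measurable rectangles, and
  \<open>sfd\<close> makes the left-hand side a product of sigma-finite measures, which its
  rectangles determine.\<close>

lemma density_PiM_prod:
  fixes M :: "'i \<Rightarrow> 'b measure"
  assumes "finite I" and sf: "\<And>i. sigma_finite_measure (M i)"
    and f[measurable]: "\<And>i. f i \<in> borel_measurable (M i)"
    and sfd: "\<And>i. sigma_finite_measure (density (M i) (f i))"
  shows "(\<Pi>\<^sub>M i\<in>I. density (M i) (f i)) = density (Pi\<^sub>M I M) (\<lambda>x. \<Prod>i\<in>I. f i (x i))"
proof -
  interpret M: product_sigma_finite M by (simp add: product_sigma_finite_def sf)
  interpret D: product_sigma_finite "\<lambda>i. density (M i) (f i)"
    by (simp add: product_sigma_finite_def sfd)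
  show ?thesis
  proof (rule D.PiM_eqI[symmetric])
    show "sets (density (Pi\<^sub>M I M) (\<lambda>x. \<Prod>i\<in>I. f i (x i))) =
        sets (\<Pi>\<^sub>M i\<in>I. density (M i) (f i))"
      by (auto intro!: sets_PiM_cong)
    fix A assume "\<And>i. i \<in> I \<Longrightarrow> A i \<in> sets (density (M i) (f i))"
    then have [measurable]: "\<And>i. i \<in> I \<Longrightarrow> A i \<in> sets (M i)" by simp
    have "emeasure (density (Pi\<^sub>M I M) (\<lambda>x. \<Prod>i\<in>I. f i (x i))) (Pi\<^sub>E I A) =
        (\<integral>\<^sup>+x. (\<Prod>i\<in>I. f i (x i)) * indicator (Pi\<^sub>E I A) x \<partial>Pi\<^sub>M I M)"
      using \<open>finite I\<close> by (subst emeasure_density) (auto intro!: sets_PiM_I_finite)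
    also have "\<dots> = (\<integral>\<^sup>+x. (\<Prod>i\<in>I. f i (x i) * indicator (A i) (x i)) \<partial>Pi\<^sub>M I M)"
    proof (rule nn_integral_cong)
      fix x assume "x \<in> space (Pi\<^sub>M I M)"
      then have "indicator (Pi\<^sub>E I A) x = (\<Prod>i\<in>I. indicator (A i) (x i) :: ennreal)"
        using \<open>finite I\<close> by (auto simp: indicator_def space_PiM PiE_def Pi_def prod_zero_iff)
      then show "(\<Prod>i\<in>I. f i (x i)) * indicator (Pi\<^sub>E I A) x =
          (\<Prod>i\<in>I. f i (x i) * indicator (A i) (x i))"
        by (simp add: prod.distrib)
    qed
    also have "\<dots> = (\<Prod>i\<in>I. \<integral>\<^sup>+y. f i y * indicator (A i) y \<partial>M i)"
      using \<open>finite I\<close> by (intro M.product_nn_integral_prod) auto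
    also have "\<dots> = (\<Prod>i\<in>I. emeasure (density (M i) (f i)) (A i))"
      by (intro prod.cong refl) (simp add: emeasure_density)
    finally show "emeasure (density (Pi\<^sub>M I M) (\<lambda>x. \<Prod>i\<in>I. f i (x i))) (Pi\<^sub>E I A) =
        (\<Prod>i\<in>I. emeasure (density (M i) (f i)) (A i))" .
  qed fact
qed

text \<open>Independence says that the joint law of the components is the product of their laws; the
  two preceding lemmas turn this product into a density on the vector type.\<close>

lemma (in prob_space) distributed_vec:
  fixes w :: "'a \<Rightarrow> 'b::euclidean_space^'n"
  assumes indep: "indep_vars (\<lambda>_. borel) (\<lambda>i \<omega>. w \<omega> $ i) UNIV"
    and distr: "\<And>i. distributed M lborel (\<lambda>\<omega>. w \<omega> $ i) (f i)"
  shows "distributed M lborel w (\<lambda>y. \<Prod>i\<in>UNIV. f i (y $ i))"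
proof -
  have f[measurable]: "\<And>i. f i \<in> borel_measurable borel"
    and w[measurable]: "\<And>i. random_variable borel (\<lambda>\<omega>. w \<omega> $ i)"
    and d: "\<And>i. distr M borel (\<lambda>\<omega>. w \<omega> $ i) = density lborel (f i)"
    using distr by (auto simp: distributed_def cong: distr_cong)
  have sfd: "sigma_finite_measure (density lborel (f i))" for i
    unfolding d[symmetric] using prob_space_distr[OF w] prob_space_imp_sigma_finite by blast
  have vec[measurable]: "(\<lambda>g. \<chi> i. g i) \<in> (\<Pi>\<^sub>M i\<in>(UNIV::'n set). (borel::'b measure)) \<rightarrow>\<^sub>M borel"
    by (rule borel_measurable_vecI) simp
  have vec'[measurable]: "(\<lambda>g. \<chi> i. g i) \<in> (\<Pi>\<^sub>M i\<in>(UNIV::'n set). (lborel::'b measure)) \<rightarrow>\<^sub>M borel"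
    using vec by (simp cong: measurable_cong_sets sets_PiM_cong)
  have comp[measurable]: "(\<lambda>y::'b^'n. y $ i) \<in> borel_measurable borel" for i
    by (intro borel_measurable_continuous_onI continuous_intros)
  have wm: "random_variable borel w"
    by (rule borel_measurable_vecI) simp
  have "distr M lborel w = distr (distr M (\<Pi>\<^sub>M i\<in>UNIV. borel) (\<lambda>\<omega>. \<lambda>i\<in>UNIV. w \<omega> $ i)) borel (\<lambda>g. \<chi> i. g i)"
    by (subst distr_distr) (auto simp: comp_def restrict_def cong: distr_cong intro!: measurable_PiM_single')
  also have "distr M (\<Pi>\<^sub>M i\<in>UNIV. borel) (\<lambda>\<omega>. \<lambda>i\<in>UNIV. w \<omega> $ i) = (\<Pi>\<^sub>M i\<in>UNIV. density lborel (f i))"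
    using indep by (subst (asm) indep_vars_iff_distr_eq_PiM) (auto simp: d)
  also have "\<dots> = density (\<Pi>\<^sub>M i\<in>UNIV. lborel) (\<lambda>x. \<Prod>i\<in>UNIV. f i (x i))"
    using sfd by (intro density_PiM_prod) (auto intro: sigma_finite_lborel)
  also have "distr \<dots> borel (\<lambda>g. \<chi> i. g i) =
      density (distr (\<Pi>\<^sub>M i\<in>UNIV. lborel) borel (\<lambda>g. \<chi> i. g i)) (\<lambda>y. \<Prod>i\<in>UNIV. f i (y $ i))"
    by (subst density_distr) (auto intro!: arg_cong2[where f="\<lambda>a b. distr a borel b"] simp: comp_def)
  finally have "distr M lborel w = density lborel (\<lambda>y. \<Prod>i\<in>UNIV. f i (y $ i))"
    unfolding lborel_vec_eq_distr_PiM[symmetric] .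
  with wm show ?thesis
    by (auto simp: distributed_def)
qed

lemma prod_complex_normal_density:
  fixes y :: "complex^'n"
  shows "(\<Prod>i\<in>UNIV. complex_normal_density (y $ i)) = (1 / pi) ^ CARD('n) * exp (- (norm y)\<^sup>2)"
  by (simp add: complex_normal_density_def norm_vec_def L2_set_def sum_nonneg prod_dividef
      exp_sum[symmetric] sum_negf power_one_over field_simps)

section \<open>Equivocation of a Gaussian mixture\<close>

lemma lborel_distr_minus:
  fixes c :: "'b::euclidean_space"
  shows "distr lborel borel (\<lambda>y. y - c) = lborel"
proof -
  have "(\<lambda>y. y - c) = (+) (- c)" by auto
  then show ?thesis by (simp only: lborel_distr_plus)
qed

lemma has_bochner_integral_lborel_translate:
  fixes f :: "'b::euclidean_space \<Rightarrow> real"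
  assumes "has_bochner_integral lborel f r"
  shows "has_bochner_integral lborel (\<lambda>y. f (y - c)) r"
proof -
  have [measurable]: "f \<in> borel_measurable borel"
    using assms by (auto simp: has_bochner_integral_iff dest: borel_measurable_integrable)
  have "has_bochner_integral (distr lborel borel (\<lambda>y. y - c)) f r"
    using assms by (simp add: lborel_distr_minus)
  then show ?thesis
    by (simp add: has_bochner_integral_iff integrable_distr_eq integral_distr)
qed

lemma sqrt_sum_le:
  fixes f :: "'i \<Rightarrow> real"
  shows "finite A \<Longrightarrow> (\<And>i. i \<in> A \<Longrightarrow> 0 \<le> f i) \<Longrightarrow> sqrt (\<Sum>i\<in>A. f i) \<le> (\<Sum>i\<in>A. sqrt (f i))"
proof (induction A rule: finite_induct)
  case (insert i A)
  have "sqrt (f i + sum f A) \<le> sqrt (f i) + sqrt (sum f A)"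
    using insert by (intro sqrt_add_le_add_sqrt) (auto intro: sum_nonneg)
  with insert show ?case by simp
qed simp

text \<open>The normalising constant \<open>k\<close> enters only through positivity and the total
  mass 1, so no Gaussian integral has to be evaluated. The assumptions leave the centres
  \<open>a\<close> free, hence the locale predicate depends on \<open>S\<close>, \<open>k\<close>
  and the output type alone.\<close>

locale gaussian_mixture =
  fixes S :: "'x::euclidean_space set" and k :: real and a :: "'x \<Rightarrow> 'b::euclidean_space"
  assumes finite_S: "finite S" and S_ne: "S \<noteq> {}" and k_pos: "0 < k"
    and has_integral_gauss: "has_bochner_integral lborel (\<lambda>y::'b. k * exp (- (norm y)\<^sup>2)) 1"
begin

definition bump :: "'x \<Rightarrow> 'b \<Rightarrow> real" where
  "bump x y = k * exp (- (norm (y - a x))\<^sup>2)"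

definition mix :: "'b \<Rightarrow> real" where
  "mix y = (\<Sum>x\<in>S. bump x y)"

text \<open>For uniform \<open>x\<close> the prior cancels, so \<open>bump x y / mix y\<close> is
  the posterior probability of \<open>x\<close> given the output \<open>y\<close>. The logarithm is
  its surprisal in nats, weighted by the density of the output given \<open>x\<close>.\<close>

definition loss :: "'x \<Rightarrow> 'b \<Rightarrow> real" where
  "loss x y = bump x y * ln (mix y / bump x y)"

text \<open>
  With \<open>x\<close> uniform on \<open>S\<close> and \<open>y = a x + w\<close>, the quantity \<open>equivocation\<close> is the conditional entropy
  of \<open>x\<close> given \<open>y\<close> in nats.
\<close>

definition equivocation :: real where
  "equivocation = (\<Sum>x\<in>S. \<integral>y. loss x y \<partial>lborel) / card S"

lemma bump_pos: "0 < bump x y"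
  using k_pos by (simp add: bump_def)

lemma bump_le: "bump x y \<le> k"
  using k_pos by (simp add: bump_def)

lemma bump_le_mix: "x \<in> S \<Longrightarrow> bump x y \<le> mix y"
  unfolding mix_def using finite_S by (intro member_le_sum) (auto intro: less_imp_le bump_pos)

lemma mix_pos: "0 < mix y"
  unfolding mix_def using finite_S S_ne by (intro sum_pos) (auto intro: bump_pos)

lemma mix_le: "mix y \<le> card S * k"
  unfolding mix_def using sum_bounded_above[of S "\<lambda>x. bump x y" k] by (auto intro: bump_le)

lemma measurable_bump[measurable]: "bump x \<in> borel_measurable borel"
  unfolding bump_def by measurable

lemma measurable_mix[measurable]: "mix \<in> borel_measurable borel"
  unfolding mix_def by measurable

lemma measurable_loss[measurable]: "loss x \<in> borel_measurable borel"
  unfolding loss_def by measurable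

lemma has_integral_bump: "has_bochner_integral lborel (bump x) 1"
  using has_bochner_integral_lborel_translate[OF has_integral_gauss, of "a x"]
  by (simp add: bump_def[abs_def])

lemma integrable_bump: "integrable lborel (bump x)"
  and integral_bump: "(\<integral>y. bump x y \<partial>lborel) = 1"
  using has_integral_bump by (auto simp: has_bochner_integral_iff)

lemma integrable_mix: "integrable lborel mix"
  unfolding mix_def by (intro Bochner_Integration.integrable_sum integrable_bump)

lemma loss_nonneg: "x \<in> S \<Longrightarrow> 0 \<le> loss x y"
  unfolding loss_def using bump_pos[of x y] bump_le_mix[of x y]
  by (intro mult_nonneg_nonneg ln_ge_zero) (auto simp: field_simps)

text \<open>From \<open>ln t \<le> t - 1\<close>. Together with \<open>loss_nonneg\<close> this
  dominates the loss by the integrable function \<open>mix\<close>.\<close>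

lemma loss_le: "loss x y \<le> mix y - bump x y"
proof -
  have "ln (mix y / bump x y) \<le> mix y / bump x y - 1"
    using bump_pos[of x y] mix_pos[of y] by (intro ln_le_minus_one) auto
  then have "loss x y \<le> bump x y * (mix y / bump x y - 1)"
    unfolding loss_def using bump_pos[of x y] by (intro mult_left_mono) auto
  then show ?thesis using bump_pos[of x y] by (simp add: right_diff_distrib)
qed

lemma integrable_loss:
  assumes "x \<in> S" shows "integrable lborel (loss x)"
proof (rule Bochner_Integration.integrable_bound[OF integrable_mix])
  show "AE y in lborel. norm (loss x y) \<le> norm (mix y)"
  proof (rule AE_I2)
    fix y show "norm (loss x y) \<le> norm (mix y)"
      using loss_nonneg[OF assms, of y] loss_le[of x y] bump_pos[of x y] by simp
  qed
qed simp

section \<open>Lower bound on the equivocation when two centres are close\<close>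

text \<open>Apply \<open>1 - 1 / t \<le> ln t\<close> to \<open>t = mix y / bump x y\<close>, keep
  only the summand of \<open>x'\<close> in \<open>mix y - bump x y\<close>, and bound the remaining
  denominator by \<open>card S * k\<close>.\<close>

lemma loss_ge:
  assumes "x \<in> S" "x' \<in> S" "x \<noteq> x'"
  shows "bump x y * bump x' y / (card S * k) \<le> loss x y"
proof -
  note pos = bump_pos[of x y] bump_pos[of x' y] mix_pos[of y]
  have "bump x y + bump x' y = sum (\<lambda>x. bump x y) {x, x'}"
    using assms by simp
  also have "\<dots> \<le> mix y"
    unfolding mix_def using assms finite_S by (intro sum_mono2) (auto intro: less_imp_le bump_pos)
  finally have le: "bump x' y \<le> mix y - bump x y" by simp
  have "ln (bump x y / mix y) \<le> bump x y / mix y - 1"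
    using pos by (intro ln_le_minus_one) auto
  then have *: "1 - bump x y / mix y \<le> ln (mix y / bump x y)"
    using pos by (simp add: ln_div)
  have "bump x y * bump x' y / (card S * k) \<le> bump x y * bump x' y / mix y"
    using pos mix_le[of y] by (intro divide_left_mono) auto
  also have "\<dots> \<le> bump x y * (1 - bump x y / mix y)"
    using le pos mult_left_mono[of "bump x' y / mix y" "1 - bump x y / mix y" "bump x y"]
    by (simp add: field_simps)
  also have "\<dots> \<le> loss x y"
    unfolding loss_def using * pos by (intro mult_left_mono) auto
  finally show ?thesis .
qed

text \<open>The second factor of the integrand is the smallest value at \<open>y\<close> of a bump
  whose centre has norm at most 1. In the denominator, \<open>card S * k\<close> comes from
  \<open>loss_ge\<close> and the other \<open>card S\<close> from averaging over the inputs. The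
  centres \<open>a\<close> do not occur, which makes the bound uniform in the SNR and the
  channel.\<close>

definition gap_constant :: real where
  "gap_constant = (\<integral>y. k * exp (- (norm y)\<^sup>2) * (k * exp (- (norm y + 1)\<^sup>2)) \<partial>(lborel :: 'b measure)) / ((card S)\<^sup>2 * k)"

lemma gap_integrable:
  "integrable lborel (\<lambda>y::'b. k * exp (- (norm y)\<^sup>2) * (k * exp (- (norm y + 1)\<^sup>2)))"
proof (rule Bochner_Integration.integrable_bound)
  show "integrable lborel (\<lambda>y::'b. k * (k * exp (- (norm y)\<^sup>2)))"
    using has_integral_gauss by (auto simp: has_bochner_integral_iff)
  show "AE y in (lborel :: 'b measure). norm (k * exp (- (norm y)\<^sup>2) * (k * exp (- (norm y + 1)\<^sup>2))) \<le>
      norm (k * (k * exp (- (norm y)\<^sup>2)))"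
    using k_pos by (intro AE_I2) (simp add: abs_mult mult_le_cancel_left)
qed measurable

text \<open>The integrand is strictly positive everywhere, so a vanishing integral would make the
  whole space a null set.\<close>

lemma gap_constant_pos: "0 < gap_constant"
proof -
  let ?f = "\<lambda>y::'b. k * exp (- (norm y)\<^sup>2) * (k * exp (- (norm y + 1)\<^sup>2))"
  have nn: "0 \<le> (\<integral>y. ?f y \<partial>lborel)"
    using k_pos by (intro integral_nonneg_AE AE_I2) simp
  have "(\<integral>y. ?f y \<partial>lborel) \<noteq> 0"
  proof
    assume "(\<integral>y. ?f y \<partial>lborel) = 0"
    then have "AE y in lborel. ?f y = 0"
      using k_pos by (subst (asm) integral_nonneg_eq_0_iff_AE[OF gap_integrable]) auto
    then have "AE y in (lborel :: 'b measure). False"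
      by eventually_elim (use k_pos in simp)
    then have "emeasure lborel (UNIV::'b set) = 0"
      using AE_iff_null[of "lborel :: 'b measure" "\<lambda>_. False"] by (simp add: null_sets_def)
    then show False by simp
  qed
  with nn have "0 < (\<integral>y. ?f y \<partial>lborel)" by linarith
  then show ?thesis
    unfolding gap_constant_def using k_pos finite_S S_ne
    by (intro divide_pos_pos) (auto simp: card_gt_0_iff)
qed

text \<open>By the triangle inequality the bump at \<open>a x'\<close> is at least the worst case
  used in \<open>gap_constant\<close>, seen from \<open>a x\<close>. Translation invariance removes
  the dependence on \<open>a x\<close>, and the nonnegative losses of the other inputs are
  dropped.\<close>

lemma equivocation_ge:
  assumes "x \<in> S" "x' \<in> S" "x \<noteq> x'" and close: "norm (a x - a x') \<le> 1"
  shows "gap_constant \<le> equivocation"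
proof -
  let ?f = "\<lambda>y::'b. k * exp (- (norm y)\<^sup>2) * (k * exp (- (norm y + 1)\<^sup>2))"
  have N: "0 < real (card S)" using finite_S S_ne by (simp add: card_gt_0_iff)
  have int: "has_bochner_integral lborel (\<lambda>y. ?f (y - a x)) (\<integral>y. ?f y \<partial>lborel)"
    using gap_integrable by (intro has_bochner_integral_lborel_translate) (rule has_bochner_integral_integrable)
  then have "(\<integral>y. ?f y \<partial>lborel) = (\<integral>y. ?f (y - a x) \<partial>lborel)"
    by (simp only: has_bochner_integral_iff)
  then have "gap_constant * card S = (\<integral>y. ?f (y - a x) / (card S * k) \<partial>lborel)"
    using N by (subst integral_divide_zero) (simp add: gap_constant_def power2_eq_square[of "real (card S)"])
  also have "\<dots> \<le> (\<integral>y. loss x y \<partial>lborel)"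
  proof (rule integral_mono)
    fix y
    have "norm (y - a x') \<le> norm (y - a x) + 1"
      using norm_triangle_ineq[of "y - a x" "a x - a x'"] close by simp
    then have "(norm (y - a x'))\<^sup>2 \<le> (norm (y - a x) + 1)\<^sup>2"
      by (intro power_mono) auto
    then have "?f (y - a x) \<le> bump x y * bump x' y"
      unfolding bump_def using k_pos by (intro mult_left_mono) auto
    then have "?f (y - a x) / (card S * k) \<le> bump x y * bump x' y / (card S * k)"
      using N k_pos by (intro divide_right_mono) auto
    also have "\<dots> \<le> loss x y" using assms by (intro loss_ge)
    finally show "?f (y - a x) / (card S * k) \<le> loss x y" .
  next
    show "integrable lborel (\<lambda>y. ?f (y - a x) / (card S * k))"
      using int by (intro integrable_divide_zero) (simp only: has_bochner_integral_iff)
  qed (use integrable_loss assms in auto)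
  also have "\<dots> \<le> (\<Sum>x\<in>S. \<integral>y. loss x y \<partial>lborel)"
    using finite_S assms
    by (intro member_le_sum[of x S "\<lambda>x. \<integral>y. loss x y \<partial>lborel"]) (auto intro!: integral_nonneg_AE AE_I2 loss_nonneg)
  finally show ?thesis
    using N by (simp add: equivocation_def field_simps)
qed

section \<open>Upper bound on the equivocation when all centres are far apart\<close>

text \<open>The parallelogram identity turns the geometric mean of two bumps into a single bump centred
  at their midpoint.\<close>

lemma has_integral_sqrt_bump:
  "has_bochner_integral lborel (\<lambda>y. sqrt (bump x y * bump x' y)) (exp (- (norm (a x - a x'))\<^sup>2 / 4))"
proof -
  let ?m = "(1/2) *\<^sub>R (a x + a x')"
  \<comment> \<open>All centres of this auxiliary mixture are the midpoint, so the first argument of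
    \<open>m.bump\<close> is a dummy.\<close>
  interpret m: gaussian_mixture S k "\<lambda>_. ?m"
    by unfold_locales (use finite_S S_ne k_pos has_integral_gauss in auto)
  have "sqrt (bump x y * bump x' y) = exp (- (norm (a x - a x'))\<^sup>2 / 4) * m.bump x y" for y
  proof (rule real_sqrt_unique)
    have "(norm (y - a x))\<^sup>2 + (norm (y - a x'))\<^sup>2 =
        2 * (norm (y - ?m))\<^sup>2 + 2 * ((norm (a x - a x'))\<^sup>2 / 4)"
      by (simp add: power2_norm_eq_inner inner_simps inner_commute field_simps)
    then have "exp (- (norm (y - a x))\<^sup>2) * exp (- (norm (y - a x'))\<^sup>2) =
        (exp (- (norm (a x - a x'))\<^sup>2 / 4) * exp (- (norm (y - ?m))\<^sup>2))\<^sup>2"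
      by (simp add: exp_add[symmetric] power2_eq_square algebra_simps)
    then show "(exp (- (norm (a x - a x'))\<^sup>2 / 4) * m.bump x y)\<^sup>2 = bump x y * bump x' y"
      by (simp add: bump_def m.bump_def power_mult_distrib) (simp add: power2_eq_square)
  qed (use m.bump_pos[of x y] in simp)
  with has_bochner_integral_mult_right[OF m.has_integral_bump, of "exp (- (norm (a x - a x'))\<^sup>2 / 4)" x]
  show ?thesis by simp
qed

text \<open>Writing \<open>ln t = 2 * ln (sqrt t) \<le> 2 * (sqrt t - 1)\<close> brings in square
  roots. Subadditivity of \<open>sqrt\<close> splits \<open>sqrt (mix y)\<close> into one term per
  input, and the term of \<open>x\<close> itself cancels against \<open>- bump x y\<close>.\<close>

lemma loss_le_sqrt:
  assumes "x \<in> S"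
  shows "loss x y \<le> 2 * (\<Sum>x'\<in>S - {x}. sqrt (bump x y * bump x' y))"
proof -
  note pos = bump_pos[of x y] mix_pos[of y]
  have "ln (mix y / bump x y) = 2 * ln (sqrt (mix y / bump x y))"
    using pos by (simp add: ln_sqrt)
  also have "\<dots> \<le> 2 * (sqrt (mix y / bump x y) - 1)"
    using pos by (intro mult_left_mono ln_le_minus_one) auto
  finally have "loss x y \<le> bump x y * (2 * (sqrt (mix y / bump x y) - 1))"
    unfolding loss_def using pos by (intro mult_left_mono) auto
  also have "\<dots> = 2 * (sqrt (bump x y) * sqrt (mix y) - bump x y)"
  proof -
    have "bump x y * sqrt (mix y / bump x y) = sqrt (bump x y) * sqrt (mix y)"
      using pos by (simp add: real_sqrt_divide field_simps)
    then show ?thesis by (simp add: algebra_simps)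
  qed
  also have "sqrt (mix y) \<le> (\<Sum>x'\<in>S. sqrt (bump x' y))"
    unfolding mix_def using finite_S by (intro sqrt_sum_le) (auto intro: less_imp_le bump_pos)
  also have "(\<Sum>x'\<in>S. sqrt (bump x' y)) = sqrt (bump x y) + (\<Sum>x'\<in>S - {x}. sqrt (bump x' y))"
    using assms finite_S by (subst sum.remove[of S x]) auto
  finally show ?thesis
    using pos by (simp add: algebra_simps sum_distrib_left real_sqrt_mult mult_left_mono)
qed

text \<open>Each competing input contributes its Bhattacharyya coefficient, the integral of the
  geometric mean of two bumps. This decays like a Gaussian in the distance of the centres, and there
  are fewer than \<open>card S\<close> competitors.\<close>

lemma equivocation_le:
  assumes far: "\<And>x x'. x \<in> S \<Longrightarrow> x' \<in> S \<Longrightarrow> x \<noteq> x' \<Longrightarrow> A \<le> norm (a x - a x')" and "0 \<le> A"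
  shows "equivocation \<le> 2 * card S * exp (- A\<^sup>2 / 4)"
proof -
  have N: "0 < real (card S)" using finite_S S_ne by (simp add: card_gt_0_iff)
  have "(\<integral>y. loss x y \<partial>lborel) \<le> 2 * card S * exp (- A\<^sup>2 / 4)" if x: "x \<in> S" for x
  proof -
    have "(\<integral>y. loss x y \<partial>lborel) \<le> (\<integral>y. 2 * (\<Sum>x'\<in>S - {x}. sqrt (bump x y * bump x' y)) \<partial>lborel)"
      using has_integral_sqrt_bump
      by (intro integral_mono loss_le_sqrt integrable_loss x)
         (auto simp: has_bochner_integral_iff intro!: integrable_mult_right Bochner_Integration.integrable_sum)
    also have "\<dots> = 2 * (\<Sum>x'\<in>S - {x}. exp (- (norm (a x - a x'))\<^sup>2 / 4))"
      using has_integral_sqrt_bump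
      by (subst integral_mult_right_zero, subst Bochner_Integration.integral_sum)
         (auto simp: has_bochner_integral_iff)
    also have "\<dots> \<le> 2 * (\<Sum>x'\<in>S - {x}. exp (- A\<^sup>2 / 4))"
      using x far \<open>0 \<le> A\<close> by (intro mult_left_mono sum_mono) (auto intro!: power_mono)
    also have "\<dots> \<le> 2 * card S * exp (- A\<^sup>2 / 4)"
      using x finite_S by (auto intro!: mult_right_mono card_mono)
    finally show ?thesis .
  qed
  then have "(\<Sum>x\<in>S. \<integral>y. loss x y \<partial>lborel) \<le> card S * (2 * card S * exp (- A\<^sup>2 / 4))"
    using sum_bounded_above[of S "\<lambda>x. \<integral>y. loss x y \<partial>lborel"] by auto
  then show ?thesis using N by (simp add: equivocation_def field_simps)
qed

end

section \<open>Mutual information over a Gaussian channel\<close>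

text \<open>The atoms in \<open>S\<close> already carry the full mass, so the complement of
  \<open>S\<close> is null. The \<open>t1_space\<close> sort makes finite sets Borel. The lemma
  turns integrals over the input law into finite averages.\<close>

lemma distr_pmf_of_set:
  fixes X :: "'a \<Rightarrow> 'x::t1_space"
  assumes "prob_space M" and X[measurable]: "X \<in> borel_measurable M" and S: "finite S" "S \<noteq> {}"
    and prob: "\<And>x. x \<in> S \<Longrightarrow> measure M {\<omega> \<in> space M. X \<omega> = x} = 1 / card S"
  shows "distr M borel X = distr (measure_pmf (pmf_of_set S)) borel (\<lambda>x. x)"
proof (rule measure_eqI)
  interpret prob_space M by fact
  have fin: "prob {\<omega> \<in> space M. X \<omega> \<in> T} = card T / card S" if "T \<subseteq> S" for T
  proof -
    have "finite T" using that S finite_subset by auto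
    have "{\<omega> \<in> space M. X \<omega> \<in> T} = (\<Union>x\<in>T. {\<omega> \<in> space M. X \<omega> = x})" by auto
    also have "prob \<dots> = (\<Sum>x\<in>T. prob {\<omega> \<in> space M. X \<omega> = x})"
      using \<open>finite T\<close> by (intro finite_measure_finite_Union) (auto simp: disjoint_family_on_def)
    also have "\<dots> = card T / card S" using that by (simp add: prob subset_iff)
    finally show ?thesis .
  qed
  have S_borel: "S \<in> sets borel" using S by (intro borel_closed finite_imp_closed)
  have [measurable]: "{\<omega> \<in> space M. X \<omega> \<in> S} \<in> sets M"
    using S_borel by measurable
  have "prob {\<omega> \<in> space M. X \<omega> \<in> S} = 1"
    using fin[of S] S by simp
  then have AE: "AE \<omega> in M. X \<omega> \<in> S"
    by (subst (asm) prob_Collect_eq_1) auto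
  fix A :: "'x set" assume "A \<in> sets (distr M borel X)"
  then have [measurable]: "A \<in> sets borel" by simp
  have "S \<inter> A \<in> sets borel" using S_borel by simp
  then have "{\<omega> \<in> space M. X \<omega> \<in> S \<inter> A} \<in> sets M" by measurable
  then have "prob {\<omega> \<in> space M. X \<omega> \<in> A} = prob {\<omega> \<in> space M. X \<omega> \<in> S \<inter> A}"
    using AE by (intro finite_measure_eq_AE) auto
  also have "\<dots> = card (S \<inter> A) / card S" by (rule fin) simp
  finally show "emeasure (distr M borel X) A = emeasure (distr (measure_pmf (pmf_of_set S)) borel (\<lambda>x. x)) A"
    using S by (simp add: emeasure_distr emeasure_pmf_of_set emeasure_eq_measure vimage_def Int_def conj_commute)
qed simp

context gaussian_mixture
begin

lemma measurable_bump_pair: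
  assumes [measurable]: "a \<in> borel_measurable borel"
  shows "(\<lambda>(x, y). bump x y) \<in> borel_measurable (borel \<Otimes>\<^sub>M borel)"
  unfolding bump_def case_prod_unfold by measurable

context
  fixes M :: "'s measure" and X :: "'s \<Rightarrow> 'x" and W :: "'s \<Rightarrow> 'b"
  assumes M: "prob_space M"
    and a[measurable]: "a \<in> borel_measurable borel"
    and X_meas: "X \<in> borel_measurable M"
    and joint: "distr M (borel \<Otimes>\<^sub>M borel) (\<lambda>\<omega>. (X \<omega>, W \<omega>)) = distr M borel X \<Otimes>\<^sub>M distr M borel W"
    and W: "distributed M lborel W (\<lambda>y. ennreal (k * exp (- (norm y)\<^sup>2)))"
    and law_X: "distr M borel X = distr (measure_pmf (pmf_of_set S)) borel (\<lambda>x. x)"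
begin

lemma random_variables: "X \<in> borel_measurable M" "W \<in> borel_measurable M"
  using X_meas W by (auto simp: distributed_def)

lemma nn_integral_input:
  assumes "f \<in> borel_measurable borel"
  shows "(\<integral>\<^sup>+x. f x \<partial>distr M borel X) = (\<Sum>x\<in>S. f x) / card S"
  unfolding law_X using assms finite_S S_ne
  by (simp add: nn_integral_distr nn_integral_pmf_of_set)

text \<open>A discrete input has no density with respect to \<open>lborel\<close>. Taking its own
  law as reference measure gives it density 1, and the joint density becomes the conditional density
  of the output given the input.\<close>

lemma distributed_joint:
  "distributed M (distr M borel X \<Otimes>\<^sub>M lborel) (\<lambda>\<omega>. (X \<omega>, a (X \<omega>) + W \<omega>)) (\<lambda>(x, y). ennreal (bump x y))"
proof -
  interpret prob_space M by (rule M)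
  note random_variables[measurable] measurable_bump_pair[OF a, measurable]
  let ?S = "distr M borel X"
  have sets: "sets (?S \<Otimes>\<^sub>M lborel) = sets (borel \<Otimes>\<^sub>M borel)" by (intro sets_pair_measure_cong) auto
  have rv: "(\<lambda>\<omega>. (X \<omega>, a (X \<omega>) + W \<omega>)) \<in> M \<rightarrow>\<^sub>M ?S \<Otimes>\<^sub>M lborel"
    by (subst measurable_cong_sets[OF refl sets]) measurable
  have dens: "(\<lambda>(x, y). ennreal (bump x y)) \<in> borel_measurable (?S \<Otimes>\<^sub>M lborel)"
    by (subst measurable_cong_sets[OF sets refl]) measurable
  have law_W: "distr M borel W = density lborel (\<lambda>y. ennreal (k * exp (- (norm y)\<^sup>2)))"
    using W by (simp add: distributed_def cong: distr_cong)
  interpret W: prob_space "distr M borel W" by (intro prob_space_distr) simp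
  have "distr M (?S \<Otimes>\<^sub>M lborel) (\<lambda>\<omega>. (X \<omega>, a (X \<omega>) + W \<omega>)) =
      density (?S \<Otimes>\<^sub>M lborel) (\<lambda>(x, y). ennreal (bump x y))"
  proof (rule measure_eqI)
    fix A assume "A \<in> sets (distr M (?S \<Otimes>\<^sub>M lborel) (\<lambda>\<omega>. (X \<omega>, a (X \<omega>) + W \<omega>)))"
    then have A': "A \<in> sets (?S \<Otimes>\<^sub>M lborel)" by simp
    with sets have A[measurable]: "A \<in> sets (borel \<Otimes>\<^sub>M borel)" by simp
    have "emeasure (distr M (?S \<Otimes>\<^sub>M lborel) (\<lambda>\<omega>. (X \<omega>, a (X \<omega>) + W \<omega>))) A =
        (\<integral>\<^sup>+z. indicator A z \<partial>distr M (?S \<Otimes>\<^sub>M lborel) (\<lambda>\<omega>. (X \<omega>, a (X \<omega>) + W \<omega>)))"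
      using A' by simp
    also have "\<dots> = (\<integral>\<^sup>+\<omega>. indicator A (X \<omega>, a (X \<omega>) + W \<omega>) \<partial>M)"
      using A' by (intro nn_integral_distr rv) simp
    also have "\<dots> = (\<integral>\<^sup>+(x, w). indicator A (x, a x + w) \<partial>distr M (borel \<Otimes>\<^sub>M borel) (\<lambda>\<omega>. (X \<omega>, W \<omega>)))"
      by (subst nn_integral_distr) auto
    also have "\<dots> = (\<integral>\<^sup>+x. \<integral>\<^sup>+w. indicator A (x, a x + w) \<partial>distr M borel W \<partial>?S)"
      unfolding joint by (subst W.nn_integral_fst[symmetric]) (auto cong: measurable_cong_sets)
    also have "\<dots> = (\<integral>\<^sup>+x. \<integral>\<^sup>+y. ennreal (bump x y) * indicator A (x, y) \<partial>lborel \<partial>?S)"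
    proof (intro nn_integral_cong)
      fix x
      have "(\<integral>\<^sup>+w. indicator A (x, a x + w) \<partial>distr M borel W) =
          (\<integral>\<^sup>+w. ennreal (k * exp (- (norm w)\<^sup>2)) * indicator A (x, a x + w) \<partial>lborel)"
        unfolding law_W by (subst nn_integral_density) auto
      \<comment> \<open>Replacing \<open>lborel\<close> by a translate of itself prepares the
        substitution \<open>w = y - a x\<close>, which turns the noise density into
        \<open>bump x\<close>.\<close>
      also have "\<dots> = (\<integral>\<^sup>+w. ennreal (k * exp (- (norm w)\<^sup>2)) * indicator A (x, a x + w) \<partial>distr lborel borel (\<lambda>y. y - a x))"
        by (simp add: lborel_distr_minus)
      also have "\<dots> = (\<integral>\<^sup>+y. ennreal (bump x y) * indicator A (x, y) \<partial>lborel)"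
        by (subst nn_integral_distr) (auto simp: bump_def)
      finally show "(\<integral>\<^sup>+w. indicator A (x, a x + w) \<partial>distr M borel W) =
          (\<integral>\<^sup>+y. ennreal (bump x y) * indicator A (x, y) \<partial>lborel)" .
    qed
    also have "\<dots> = (\<integral>\<^sup>+z. (case z of (x, y) \<Rightarrow> ennreal (bump x y)) * indicator A z \<partial>(?S \<Otimes>\<^sub>M lborel))"
      using dens A' by (subst lborel.nn_integral_fst[symmetric]) auto
    also have "\<dots> = emeasure (density (?S \<Otimes>\<^sub>M lborel) (\<lambda>(x, y). ennreal (bump x y))) A"
      using dens A' by (subst emeasure_density) auto
    finally show "emeasure (distr M (?S \<Otimes>\<^sub>M lborel) (\<lambda>\<omega>. (X \<omega>, a (X \<omega>) + W \<omega>))) A =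
      emeasure (density (?S \<Otimes>\<^sub>M lborel) (\<lambda>(x, y). ennreal (bump x y))) A" .
  qed simp
  with rv dens show ?thesis by (simp add: distributed_def)
qed

lemma distributed_output:
  "distributed M lborel (\<lambda>\<omega>. a (X \<omega>) + W \<omega>) (\<lambda>y. ennreal (mix y / card S))"
proof -
  interpret prob_space M by (rule M)
  note random_variables[measurable] measurable_bump_pair[OF a, measurable]
  interpret X: prob_space "distr M borel X" by (intro prob_space_distr) simp
  have "distributed M lborel (\<lambda>\<omega>. a (X \<omega>) + W \<omega>) (\<lambda>y. \<integral>\<^sup>+x. ennreal (bump x y) \<partial>distr M borel X)"
    using distr_marginal2[OF X.sigma_finite_measure_axioms sigma_finite_lborel distributed_joint] by simp
  also have "(\<lambda>y. \<integral>\<^sup>+x. ennreal (bump x y) \<partial>distr M borel X) = (\<lambda>y. ennreal (mix y / card S))"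
  proof
    fix y
    have "(\<integral>\<^sup>+x. ennreal (bump x y) \<partial>distr M borel X) = (\<Sum>x\<in>S. ennreal (bump x y)) / card S"
      by (intro nn_integral_input) measurable
    also have "\<dots> = ennreal (mix y / card S)"
      using finite_S S_ne bump_pos mix_pos[of y]
      by (simp add: mix_def less_imp_le divide_ennreal ennreal_of_nat_eq_real_of_nat card_gt_0_iff)
    finally show "(\<integral>\<^sup>+x. ennreal (bump x y) \<partial>distr M borel X) = ennreal (mix y / card S)" .
  qed
  finally show ?thesis .
qed

text \<open>This is the identity I(X;Y) = H(X) - H(X|Y): the integrand of the divergence splits
  pointwise into a multiple of \<open>bump\<close> and the loss. Division by \<open>ln 2\<close>
  converts nats to bits.\<close>

lemma mutual_information_eq:
  "prob_space.mutual_information M 2 borel borel X (\<lambda>\<omega>. a (X \<omega>) + W \<omega>) =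
    log 2 (card S) - equivocation / ln 2"
proof -
  interpret prob_space M by (rule M)
  interpret information_space M 2 by unfold_locales simp
  note random_variables[measurable] measurable_bump_pair[OF a, measurable]
  let ?S = "distr M borel X"
  let ?Y = "\<lambda>\<omega>. a (X \<omega>) + W \<omega>"
  interpret X: prob_space ?S by (intro prob_space_distr) simp
  interpret XY: pair_sigma_finite ?S lborel ..
  have N: "0 < real (card S)" using finite_S S_ne by (simp add: card_gt_0_iff)
  \<comment> \<open>The integrand of the divergence: joint density times the logarithm of its ratio
    to the product of the marginal densities, which are 1 for the input and
    \<open>mix y / card S\<close> for the output.\<close>
  define F where "F x y = bump x y * log 2 (bump x y / (mix y / card S))" for x y
  have F_eq: "F x y = log 2 (card S) * bump x y - loss x y / ln 2" for x y
    using N bump_pos[of x y] mix_pos[of y]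
    by (simp add: F_def loss_def log_def ln_div ln_mult field_simps)
  have F_int: "integrable lborel (F x)"
    and F_integral: "(\<integral>y. F x y \<partial>lborel) = log 2 (card S) - (\<integral>y. loss x y \<partial>lborel) / ln 2" if "x \<in> S" for x
    unfolding F_eq[abs_def] using integrable_loss[OF that] integrable_bump[of x]
    by (simp_all add: integral_bump)
  have sets: "sets (?S \<Otimes>\<^sub>M lborel) = sets (borel \<Otimes>\<^sub>M borel)" by (intro sets_pair_measure_cong) auto
  have F_meas: "(\<lambda>(x, y). F x y) \<in> borel_measurable (borel \<Otimes>\<^sub>M borel)"
    unfolding F_def by measurable
  then have F_meas'[measurable]: "(\<lambda>(x, y). F x y) \<in> borel_measurable (?S \<Otimes>\<^sub>M lborel)"
    by (subst measurable_cong_sets[OF sets refl])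
  have AE_S: "AE x in ?S. x \<in> S"
    unfolding law_X using finite_S S_ne
    by (subst AE_distr_iff) (auto simp: AE_measure_pmf_iff intro: borel_closed finite_imp_closed)
  \<comment> \<open>The input law has finite support, so every real Borel function is
    integrable.\<close>
  have input: "integrable ?S f" "(\<integral>x. f x \<partial>?S) = (\<Sum>x\<in>S. f x) / card S"
    if "f \<in> borel_measurable borel" for f :: "'x \<Rightarrow> real"
    unfolding law_X using that finite_S S_ne
    by (auto simp: integrable_distr_eq integral_distr integral_pmf_of_set set_pmf_of_set[OF S_ne finite_S] intro!: integrable_measure_pmf_finite)
  have F_section: "(\<lambda>x. \<integral>y. f (F x y) \<partial>lborel) \<in> borel_measurable borel"
    if [measurable]: "f \<in> borel_measurable borel" for f :: "real \<Rightarrow> real"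
    using F_meas by measurable
  have int: "integrable (?S \<Otimes>\<^sub>M lborel) (\<lambda>(x, y). F x y)"
  proof (rule XY.Fubini_integrable)
    show "integrable ?S (\<lambda>x. \<integral>y. norm (case (x, y) of (x, y) \<Rightarrow> F x y) \<partial>lborel)"
      using F_section[of norm] by (intro input) simp
    show "AE x in ?S. integrable lborel (\<lambda>y. case (x, y) of (x, y) \<Rightarrow> F x y)"
      using AE_S by eventually_elim (simp add: F_int)
  qed fact
  \<comment> \<open>The definition uses only the sigma-algebras of its reference measures, so
    \<open>borel\<close> may be exchanged for the measures to which the densities refer.\<close>
  have "mutual_information 2 borel borel X ?Y = mutual_information 2 ?S lborel X ?Y"
    unfolding mutual_information_def
    by (intro arg_cong2[where f="KL_divergence 2"] arg_cong2[where f="(\<Otimes>\<^sub>M)"] distr_cong)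
       (auto simp: sets)
  also have "\<dots> = (\<integral>z. (\<lambda>(x, y). F x y) z \<partial>(?S \<Otimes>\<^sub>M lborel))"
  proof -
    have PX: "distributed M ?S X (\<lambda>x. ennreal 1)"
      by (auto simp: distributed_def density_1 intro!: distr_cong)
    show ?thesis
      using mutual_information_distr[OF X.sigma_finite_measure_axioms sigma_finite_lborel PX _
          distributed_output _ , of "\<lambda>(x, y). bump x y"] distributed_joint mix_pos bump_pos
      by (auto simp: less_imp_le F_def case_prod_unfold)
  qed
  also have "\<dots> = (\<integral>x. \<integral>y. F x y \<partial>lborel \<partial>?S)"
    using XY.integral_fst'[OF int] by simp
  also have "\<dots> = (\<Sum>x\<in>S. \<integral>y. F x y \<partial>lborel) / card S"
    using F_section[of "\<lambda>x. x"] by (intro input) simp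
  also have "\<dots> = (\<Sum>x\<in>S. log 2 (card S) - (\<integral>y. loss x y \<partial>lborel) / ln 2) / card S"
    by (simp add: F_integral)
  also have "\<dots> = log 2 (card S) - equivocation / ln 2"
    using N by (simp add: equivocation_def sum_subtractf sum_divide_distrib[symmetric] field_simps)
  finally show ?thesis .
qed

end

end

section \<open>Small ball probabilities\<close>

lemma emeasure_lborel_cball_complex:
  "0 \<le> r \<Longrightarrow> emeasure lborel (cball (c::complex) r) = ennreal (pi * r\<^sup>2)"
  by (simp add: emeasure_cball unit_ball_vol_2)

lemma measurable_complex_normal_density[measurable]: "complex_normal_density \<in> borel_measurable borel"
  unfolding complex_normal_density_def by measurable

text \<open>The balls of integer radius cover the whole space, and countably many null events
  cannot.\<close>

lemma (in prob_space) ex_bounded_prob_pos: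
  fixes Y :: "'a \<Rightarrow> 'b::real_normed_vector"
  assumes [measurable]: "Y \<in> borel_measurable M"
  obtains K where "0 \<le> K" "0 < prob {\<omega> \<in> space M. norm (Y \<omega>) \<le> K}"
proof -
  have "\<exists>n::nat. prob {\<omega> \<in> space M. norm (Y \<omega>) \<le> n} \<noteq> 0"
  proof (rule ccontr)
    assume "\<not> ?thesis"
    then have "emeasure M (\<Union>n::nat. {\<omega> \<in> space M. norm (Y \<omega>) \<le> n}) = 0"
      by (intro emeasure_UN_eq_0) (auto simp: emeasure_eq_measure)
    moreover have "(\<Union>n::nat. {\<omega> \<in> space M. norm (Y \<omega>) \<le> n}) = space M"
      using real_arch_simple by auto
    ultimately show False by (simp add: emeasure_space_1)
  qed
  then obtain n :: nat where "prob {\<omega> \<in> space M. norm (Y \<omega>) \<le> n} \<noteq> 0" by auto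
  then show ?thesis
    by (intro that[of "real n"]) (auto simp: zero_less_measure_iff)
qed

text \<open>Given \<open>Y\<close>, the event says that \<open>X\<close> lies in the disc of radius
  \<open>\<epsilon> / cmod a\<close> around \<open>- Y / a\<close>. The Gaussian density is at most
  \<open>1 / pi\<close>, which gives the upper bound. For the lower bound \<open>Y\<close> is
  confined to a ball of positive probability, so that these discs stay where the density is bounded
  below.\<close>

lemma (in prob_space) small_ball:
  fixes X Y :: "'a \<Rightarrow> complex"
  assumes indep: "indep_var borel X borel Y"
    and X: "distributed M lborel X (\<lambda>c. ennreal (complex_normal_density c))"
    and a: "a \<noteq> 0"
  shows small_ball_upper: "0 \<le> \<epsilon> \<Longrightarrow> prob {\<omega> \<in> space M. cmod (a * X \<omega> + Y \<omega>) \<le> \<epsilon>} \<le> (\<epsilon> / cmod a)\<^sup>2"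
    and small_ball_lower: "\<exists>c>0. \<forall>\<epsilon>. 0 \<le> \<epsilon> \<and> \<epsilon> \<le> 1 \<longrightarrow>
          c * \<epsilon>\<^sup>2 \<le> prob {\<omega> \<in> space M. cmod (a * X \<omega> + Y \<omega>) \<le> \<epsilon>}"
proof -
  have [measurable]: "random_variable borel X" "random_variable borel Y"
    using indep_var_rv1[OF indep] indep_var_rv2[OF indep] by auto
  interpret X: prob_space "distr M borel X" by (rule prob_space_distr) simp
  interpret Y: prob_space "distr M borel Y" by (rule prob_space_distr) simp
  interpret XY: pair_sigma_finite "distr M borel X" "distr M borel Y" ..
  have law_X: "distr M borel X = density lborel (\<lambda>c. ennreal (complex_normal_density c))"
    using X by (simp add: distributed_def cong: distr_cong)
  \<comment> \<open>\<open>F \<epsilon> y\<close> is the probability of the event given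
    \<open>Y = y\<close>.\<close>
  define F where "F \<epsilon> y = (\<integral>\<^sup>+x. ennreal (complex_normal_density x) * indicator (cball (- y / a) (\<epsilon> / cmod a)) x \<partial>lborel)"
    for \<epsilon> y
  have F: "emeasure M {\<omega> \<in> space M. cmod (a * X \<omega> + Y \<omega>) \<le> \<epsilon>} = (\<integral>\<^sup>+\<omega>. F \<epsilon> (Y \<omega>) \<partial>M)" for \<epsilon>
  proof -
    let ?B = "{z \<in> space (borel \<Otimes>\<^sub>M borel). cmod (a * fst z + snd z) \<le> \<epsilon>}"
    have B[measurable]: "?B \<in> sets (borel \<Otimes>\<^sub>M borel)" by measurable
    have B': "?B \<in> sets (distr M borel X \<Otimes>\<^sub>M distr M borel Y)"
      using B by (simp cong: sets_pair_measure_cong)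
    have sec: "emeasure (distr M borel X) ((\<lambda>x. (x, y)) -` ?B) = F \<epsilon> y" for y
    proof -
      have "cmod (a * x + y) \<le> \<epsilon> \<longleftrightarrow> x \<in> cball (- y / a) (\<epsilon> / cmod a)" for x
      proof -
        have "cmod (a * x + y) = cmod (a * (x - (- y / a)))" using a by (simp add: distrib_left add.commute)
        also have "\<dots> = cmod a * dist x (- y / a)" by (simp only: norm_mult dist_norm)
        finally show ?thesis
          using a by (simp only: mem_cball dist_commute[of "- y / a" x]) (simp add: field_simps)
      qed
      then have "(\<lambda>x. (x, y)) -` ?B = cball (- y / a) (\<epsilon> / cmod a)"
        by (simp add: set_eq_iff space_pair_measure del: mem_cball)
      then show ?thesis
        unfolding law_X F_def by (simp add: emeasure_density)
    qed
    have "emeasure M {\<omega> \<in> space M. cmod (a * X \<omega> + Y \<omega>) \<le> \<epsilon>} =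
        emeasure (distr M (borel \<Otimes>\<^sub>M borel) (\<lambda>\<omega>. (X \<omega>, Y \<omega>))) ?B"
      by (subst emeasure_distr[OF _ B]) (auto intro!: arg_cong[where f="emeasure M"] simp: space_pair_measure)
    also have "distr M (borel \<Otimes>\<^sub>M borel) (\<lambda>\<omega>. (X \<omega>, Y \<omega>)) = distr M borel X \<Otimes>\<^sub>M distr M borel Y"
      using indep unfolding indep_var_distribution_eq by auto
    also have "emeasure \<dots> ?B = (\<integral>\<^sup>+y. F \<epsilon> y \<partial>distr M borel Y)"
      by (simp only: XY.emeasure_pair_measure_alt2[OF B'] sec)
    finally have eq: "emeasure M {\<omega> \<in> space M. cmod (a * X \<omega> + Y \<omega>) \<le> \<epsilon>} =
      (\<integral>\<^sup>+y. F \<epsilon> y \<partial>distr M borel Y)" .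
    have "F \<epsilon> \<in> borel_measurable (distr M borel Y)"
      using XY.measurable_emeasure_Pair2[OF B'] by (simp only: sec)
    then show "emeasure M {\<omega> \<in> space M. cmod (a * X \<omega> + Y \<omega>) \<le> \<epsilon>} = (\<integral>\<^sup>+\<omega>. F \<epsilon> (Y \<omega>) \<partial>M)"
      unfolding eq by (intro nn_integral_distr) auto
  qed
  show "prob {\<omega> \<in> space M. cmod (a * X \<omega> + Y \<omega>) \<le> \<epsilon>} \<le> (\<epsilon> / cmod a)\<^sup>2" if \<epsilon>: "0 \<le> \<epsilon>" for \<epsilon>
  proof -
    have F_le: "F \<epsilon> y \<le> ennreal ((\<epsilon> / cmod a)\<^sup>2)" for y
    proof -
      have "F \<epsilon> y \<le> (\<integral>\<^sup>+x. ennreal (1 / pi) * indicator (cball (- y / a) (\<epsilon> / cmod a)) x \<partial>lborel)"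
        unfolding F_def
        by (intro nn_integral_mono mult_right_mono ennreal_leI) (auto simp: complex_normal_density_def divide_right_mono)
      also have "\<dots> = ennreal (1 / pi) * ennreal (pi * (\<epsilon> / cmod a)\<^sup>2)"
        using \<epsilon> by (subst nn_integral_cmult_indicator) (auto simp: emeasure_lborel_cball_complex)
      also have "\<dots> = ennreal ((\<epsilon> / cmod a)\<^sup>2)"
        by (subst ennreal_mult'[symmetric]) auto
      finally show ?thesis .
    qed
    have "emeasure M {\<omega> \<in> space M. cmod (a * X \<omega> + Y \<omega>) \<le> \<epsilon>} \<le> (\<integral>\<^sup>+\<omega>. ennreal ((\<epsilon> / cmod a)\<^sup>2) \<partial>M)"
      unfolding F by (intro nn_integral_mono F_le)
    then show ?thesis
      by (simp add: emeasure_space_1 emeasure_eq_measure prob_space)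
  qed
  obtain K where K: "0 \<le> K" "0 < prob {\<omega> \<in> space M. cmod (Y \<omega>) \<le> K}"
    by (rule ex_bounded_prob_pos[of Y]) auto
  \<comment> \<open>For \<open>cmod y \<le> K\<close> and \<open>\<epsilon> \<le> 1\<close> every
    disc in question lies in the ball of radius \<open>(1 + K) / cmod a\<close> around 0, where the
    density is at least \<open>m / pi\<close>.\<close>
  define m where "m = exp (- ((1 + K) / cmod a)\<^sup>2)"
  define c where "c = m / (cmod a)\<^sup>2 * prob {\<omega> \<in> space M. cmod (Y \<omega>) \<le> K}"
  have "c * \<epsilon>\<^sup>2 \<le> prob {\<omega> \<in> space M. cmod (a * X \<omega> + Y \<omega>) \<le> \<epsilon>}" if \<epsilon>: "0 \<le> \<epsilon>" "\<epsilon> \<le> 1" for \<epsilon>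
  proof -
    have F_ge: "ennreal (m * (\<epsilon> / cmod a)\<^sup>2) \<le> F \<epsilon> y" if y: "cmod y \<le> K" for y
    proof -
      have dens: "m / pi \<le> complex_normal_density x" if "x \<in> cball (- y / a) (\<epsilon> / cmod a)" for x
      proof -
        have "cmod x \<le> cmod (- y / a) + cmod (x - (- y / a))"
          using norm_triangle_ineq[of "- y / a" "x - (- y / a)"] by simp
        also have "\<dots> \<le> K / cmod a + 1 / cmod a"
          using that y \<epsilon> a
          by (intro add_mono) (auto simp: norm_divide dist_norm norm_minus_commute divide_right_mono intro: order_trans[OF _ divide_right_mono])
        finally have "cmod x \<le> (1 + K) / cmod a" by (simp add: add_divide_distrib)
        then have "(cmod x)\<^sup>2 \<le> ((1 + K) / cmod a)\<^sup>2" by (intro power_mono) auto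
        then show ?thesis by (auto simp: m_def complex_normal_density_def intro!: divide_right_mono)
      qed
      have "ennreal (m * (\<epsilon> / cmod a)\<^sup>2) = ennreal (m / pi) * ennreal (pi * (\<epsilon> / cmod a)\<^sup>2)"
        by (subst ennreal_mult'[symmetric]) (auto simp: m_def)
      also have "\<dots> = (\<integral>\<^sup>+x. ennreal (m / pi) * indicator (cball (- y / a) (\<epsilon> / cmod a)) x \<partial>lborel)"
        using \<epsilon> by (subst nn_integral_cmult_indicator) (auto simp: emeasure_lborel_cball_complex)
      also have "\<dots> \<le> F \<epsilon> y"
        unfolding F_def by (intro nn_integral_mono) (auto split: split_indicator intro!: ennreal_leI dens)
      finally show ?thesis .
    qed
    have "ennreal (m * (\<epsilon> / cmod a)\<^sup>2) * emeasure M {\<omega> \<in> space M. cmod (Y \<omega>) \<le> K} =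
        (\<integral>\<^sup>+\<omega>. ennreal (m * (\<epsilon> / cmod a)\<^sup>2) * indicator {\<omega> \<in> space M. cmod (Y \<omega>) \<le> K} \<omega> \<partial>M)"
      by (subst nn_integral_cmult_indicator) auto
    also have "\<dots> \<le> (\<integral>\<^sup>+\<omega>. F \<epsilon> (Y \<omega>) \<partial>M)"
      by (intro nn_integral_mono) (auto split: split_indicator intro!: F_ge)
    also have "\<dots> = emeasure M {\<omega> \<in> space M. cmod (a * X \<omega> + Y \<omega>) \<le> \<epsilon>}" by (rule F[symmetric])
    finally show ?thesis
      unfolding emeasure_eq_measure
      by (subst (asm) ennreal_mult'[symmetric]) (auto simp: c_def m_def power_divide field_simps)
  qed
  moreover have "0 < c" using K a by (simp add: c_def m_def)
  ultimately show "\<exists>c>0. \<forall>\<epsilon>. 0 \<le> \<epsilon> \<and> \<epsilon> \<le> 1 \<longrightarrow>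
      c * \<epsilon>\<^sup>2 \<le> prob {\<omega> \<in> space M. cmod (a * X \<omega> + Y \<omega>) \<le> \<epsilon>}"
    by blast
qed

section \<open>Small balls for the image of a fixed nonzero vector under the channel\<close>

context prob_space
begin

context
  fixes H :: "'a \<Rightarrow> complex^'t^'r" and v :: "complex^'t"
  assumes H_indep: "indep_vars (\<lambda>_. borel) (\<lambda>(i, j) \<omega>. H \<omega> $ i $ j) UNIV"
    and H_distr: "\<And>i j. distributed M lborel (\<lambda>\<omega>. H \<omega> $ i $ j) (\<lambda>c. ennreal (complex_normal_density c))"
    and v: "v \<noteq> 0"
begin

text \<open>Different components are functions of disjoint rows of \<open>H\<close>, and all entries
  are independent.\<close>

lemma indep_rows: "indep_vars (\<lambda>_. borel) (\<lambda>i \<omega>. (H \<omega> *v v) $ i) UNIV"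
proof -
  have "indep_vars (\<lambda>i. \<Pi>\<^sub>M p\<in>{i} \<times> UNIV. borel)
      (\<lambda>i \<omega>. \<lambda>p\<in>{i} \<times> UNIV. (\<lambda>(i, j) \<omega>. H \<omega> $ i $ j) p \<omega>) (UNIV :: 'r set)"
    by (rule indep_vars_restrict[OF H_indep]) (auto simp: disjoint_family_on_def)
  then have "indep_vars (\<lambda>_. borel)
      (\<lambda>i \<omega>. (\<lambda>f. \<Sum>j\<in>UNIV. f (i, j) * v $ j) (\<lambda>p\<in>{i} \<times> UNIV. (\<lambda>(i, j) \<omega>. H \<omega> $ i $ j) p \<omega>)) (UNIV :: 'r set)"
    by (rule indep_vars_compose2) measurable
  then show ?thesis
    by (simp add: matrix_vector_mult_def)
qed

text \<open>Isolating one entry with a nonzero coefficient puts a component into the form required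
  by \<open>small_ball\<close>, the rest of the row serving as \<open>Y\<close>.\<close>

lemma row_split:
  assumes j: "v $ j \<noteq> 0"
  obtains Y where "indep_var borel (\<lambda>\<omega>. H \<omega> $ i $ j) borel Y"
    and "\<And>\<omega>. (H \<omega> *v v) $ i = v $ j * H \<omega> $ i $ j + Y \<omega>"
proof
  let ?R = "\<lambda>A \<omega>. \<lambda>p\<in>A. (\<lambda>(i, j) \<omega>. H \<omega> $ i $ j) p \<omega>"
  let ?B = "{i} \<times> (UNIV - {j})"
  have "indep_var (PiM {(i, j)} (\<lambda>_. borel)) (?R {(i, j)}) (PiM ?B (\<lambda>_. borel)) (?R ?B)"
    by (rule indep_var_restrict[OF H_indep]) auto
  then have "indep_var borel ((\<lambda>f. f (i, j)) \<circ> ?R {(i, j)})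
      borel ((\<lambda>f. \<Sum>j'\<in>UNIV - {j}. f (i, j') * v $ j') \<circ> ?R ?B)"
    by (rule indep_var_compose) measurable
  also have "(\<lambda>f. f (i, j)) \<circ> ?R {(i, j)} = (\<lambda>\<omega>. H \<omega> $ i $ j)"
    by auto
  also have "(\<lambda>f. \<Sum>j'\<in>UNIV - {j}. f (i, j') * v $ j') \<circ> ?R ?B =
      (\<lambda>\<omega>. \<Sum>j'\<in>UNIV - {j}. H \<omega> $ i $ j' * v $ j')"
    by (auto simp: comp_def)
  finally show "indep_var borel (\<lambda>\<omega>. H \<omega> $ i $ j) borel
      (\<lambda>\<omega>. \<Sum>j'\<in>UNIV - {j}. H \<omega> $ i $ j' * v $ j')" .
  show "(H \<omega> *v v) $ i = v $ j * H \<omega> $ i $ j + (\<Sum>j'\<in>UNIV - {j}. H \<omega> $ i $ j' * v $ j')" for \<omega>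
    by (simp add: matrix_vector_mult_def sum.remove[of UNIV j] mult.commute)
qed

lemma prob_rows:
  "prob {\<omega> \<in> space M. \<forall>i. cmod ((H \<omega> *v v) $ i) \<le> \<epsilon>} =
    (\<Prod>i\<in>UNIV. prob {\<omega> \<in> space M. cmod ((H \<omega> *v v) $ i) \<le> \<epsilon>})"
proof -
  have "prob (\<Inter>i\<in>UNIV. (\<lambda>\<omega>. (H \<omega> *v v) $ i) -` cball 0 \<epsilon> \<inter> space M) =
      (\<Prod>i\<in>UNIV. prob ((\<lambda>\<omega>. (H \<omega> *v v) $ i) -` cball 0 \<epsilon> \<inter> space M))"
    by (rule indep_varsD_finite[OF indep_rows]) auto
  moreover have "(\<Inter>i\<in>UNIV. (\<lambda>\<omega>. (H \<omega> *v v) $ i) -` cball 0 \<epsilon> \<inter> space M) =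
      {\<omega> \<in> space M. \<forall>i. cmod ((H \<omega> *v v) $ i) \<le> \<epsilon>}"
    by auto
  moreover have "(\<lambda>\<omega>. (H \<omega> *v v) $ i) -` cball 0 \<epsilon> \<inter> space M =
      {\<omega> \<in> space M. cmod ((H \<omega> *v v) $ i) \<le> \<epsilon>}" for i
    by auto
  ultimately show ?thesis by simp
qed

text \<open>Each receive antenna contributes one independent factor of order
  \<open>\<epsilon>\<^sup>2\<close>. This is where the receive diversity comes from, since
  \<open>\<epsilon>\<close> will be of order \<open>1 / sqrt \<gamma>\<close>.\<close>

lemma channel_small_ball_upper:
  "\<exists>K>0. \<forall>\<epsilon>\<ge>0. prob {\<omega> \<in> space M. \<forall>i. cmod ((H \<omega> *v v) $ i) \<le> \<epsilon>} \<le> K * (\<epsilon>\<^sup>2) ^ CARD('r)"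
proof -
  obtain j where j: "v $ j \<noteq> 0" using v by (auto simp: vec_eq_iff)
  have "prob {\<omega> \<in> space M. \<forall>i. cmod ((H \<omega> *v v) $ i) \<le> \<epsilon>} \<le> (1 / (cmod (v $ j))\<^sup>2) ^ CARD('r) * (\<epsilon>\<^sup>2) ^ CARD('r)"
    if "0 \<le> \<epsilon>" for \<epsilon>
  proof -
    have "prob {\<omega> \<in> space M. cmod ((H \<omega> *v v) $ i) \<le> \<epsilon>} \<le> (\<epsilon> / cmod (v $ j))\<^sup>2" for i
    proof (rule row_split[OF j, of i])
      fix Y assume Y: "indep_var borel (\<lambda>\<omega>. H \<omega> $ i $ j) borel Y"
        "\<And>\<omega>. (H \<omega> *v v) $ i = v $ j * H \<omega> $ i $ j + Y \<omega>"
      show ?thesis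
        unfolding Y(2) by (rule small_ball_upper[OF Y(1) H_distr j that])
    qed
    then have "prob {\<omega> \<in> space M. \<forall>i. cmod ((H \<omega> *v v) $ i) \<le> \<epsilon>} \<le> (\<Prod>i\<in>(UNIV::'r set). (\<epsilon> / cmod (v $ j))\<^sup>2)"
      unfolding prob_rows by (intro prod_mono) auto
    then show ?thesis by (simp add: power_divide)
  qed
  moreover have "0 < (1 / (cmod (v $ j))\<^sup>2) ^ CARD('r)" using j by simp
  ultimately show ?thesis by blast
qed

text \<open>The constants of the single components may depend on the row; the finite product of
  these positive numbers serves for the whole vector.\<close>

lemma channel_small_ball_lower:
  "\<exists>c>0. \<forall>\<epsilon>. 0 \<le> \<epsilon> \<and> \<epsilon> \<le> 1 \<longrightarrow>
    c * (\<epsilon>\<^sup>2) ^ CARD('r) \<le> prob {\<omega> \<in> space M. \<forall>i. cmod ((H \<omega> *v v) $ i) \<le> \<epsilon>}"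
proof -
  obtain j where j: "v $ j \<noteq> 0" using v by (auto simp: vec_eq_iff)
  define Q where "Q i c \<longleftrightarrow> c > 0 \<and> (\<forall>\<epsilon>. 0 \<le> \<epsilon> \<and> \<epsilon> \<le> 1 \<longrightarrow>
      c * \<epsilon>\<^sup>2 \<le> prob {\<omega> \<in> space M. cmod ((H \<omega> *v v) $ i) \<le> \<epsilon>})" for i c
  have "\<exists>c. Q i c" for i
  proof (rule row_split[OF j, of i])
    fix Y assume Y: "indep_var borel (\<lambda>\<omega>. H \<omega> $ i $ j) borel Y"
      "\<And>\<omega>. (H \<omega> *v v) $ i = v $ j * H \<omega> $ i $ j + Y \<omega>"
    show ?thesis
      unfolding Q_def Y(2) by (rule small_ball_lower[OF Y(1) H_distr j])
  qed
  then obtain c where "\<And>i. Q i (c i)"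
    using choice[of Q] by auto
  then have c: "\<And>i. 0 < c i"
    "\<And>i \<epsilon>. 0 \<le> \<epsilon> \<Longrightarrow> \<epsilon> \<le> 1 \<Longrightarrow> c i * \<epsilon>\<^sup>2 \<le> prob {\<omega> \<in> space M. cmod ((H \<omega> *v v) $ i) \<le> \<epsilon>}"
    by (auto simp: Q_def)
  have "(\<Prod>i\<in>UNIV. c i) * (\<epsilon>\<^sup>2) ^ CARD('r) \<le> prob {\<omega> \<in> space M. \<forall>i. cmod ((H \<omega> *v v) $ i) \<le> \<epsilon>}"
    if "0 \<le> \<epsilon>" "\<epsilon> \<le> 1" for \<epsilon>
  proof -
    have "(\<Prod>i\<in>UNIV. c i) * (\<epsilon>\<^sup>2) ^ CARD('r) = (\<Prod>i\<in>UNIV. c i * \<epsilon>\<^sup>2)"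
      by (simp add: prod.distrib)
    also have "\<dots> \<le> (\<Prod>i\<in>UNIV. prob {\<omega> \<in> space M. cmod ((H \<omega> *v v) $ i) \<le> \<epsilon>})"
      using c that by (intro prod_mono) (auto intro!: mult_nonneg_nonneg less_imp_le[OF c(1)])
    finally show ?thesis by (simp add: prob_rows)
  qed
  moreover have "0 < (\<Prod>i\<in>UNIV. c i)" using c by (intro prod_pos) auto
  ultimately show ?thesis by blast
qed

end

end

section \<open>Outage\<close>

text \<open>The rank of an index, the number of smaller ones, is an injection into
  \<open>{..<CARD('n)}\<close>, hence a bijection by counting.\<close>

lemma card_first_indices:
  assumes "k \<le> CARD('n::{finite, linorder})"
  shows "card (first_indices k :: 'n set) = k"
proof -
  define rank where "rank j = card {i. i < j}" for j :: 'n
  have mono: "rank i < rank j" if "i < j" for i j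
    unfolding rank_def using that by (intro psubset_card_mono) auto
  have inj: "inj rank"
    by (rule injI) (metis mono less_irrefl linorder_neqE)
  have "rank j < CARD('n)" for j
    unfolding rank_def by (intro psubset_card_mono) auto
  then have "range rank = {..<CARD('n)}"
    using inj by (intro card_subset_eq) (auto simp: card_image)
  moreover have "first_indices k = rank -` {..<k}"
    by (auto simp: first_indices_def rank_def)
  ultimately have "rank ` first_indices k = {..<k}"
    using assms by auto
  then show ?thesis
    using inj by (metis card_image card_lessThan inj_on_subset subset_UNIV)
qed

lemma distr_pair_snd:
  assumes "prob_space M" "prob_space N"
  shows "distr (M \<Otimes>\<^sub>M N) N snd = N"
proof (rule measure_eqI)
  interpret M: prob_space M by fact
  interpret N: prob_space N by fact
  fix A assume "A \<in> sets (distr (M \<Otimes>\<^sub>M N) N snd)"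
  then have A: "A \<in> sets N" by simp
  have "snd -` A \<inter> space (M \<Otimes>\<^sub>M N) = space M \<times> A"
    using sets.sets_into_space[OF A] by (auto simp: space_pair_measure)
  then show "emeasure (distr (M \<Otimes>\<^sub>M N) N snd) A = emeasure N A"
    using A by (simp add: emeasure_distr N.emeasure_pair_measure_Times M.emeasure_space_1)
qed simp

lemma borel_measurable_matrix_vector_mult:
  fixes x :: "complex^'n"
  assumes "H \<in> borel_measurable M"
  shows "(\<lambda>\<omega>. (H \<omega> :: complex^'n^'m) *v x) \<in> borel_measurable M"
proof -
  have "(\<lambda>h :: complex^'n^'m. h *v x) \<in> borel_measurable borel"
    unfolding matrix_vector_mult_def
    by (intro borel_measurable_continuous_onI continuous_intros)
  from measurable_compose[OF assms this] show ?thesis .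
qed

lemma matrix_vector_mult_scaleR_right:
  fixes A :: "complex^'n^'m"
  shows "A *v (c *\<^sub>R x) = c *\<^sub>R (A *v x)"
  by (simp add: matrix_vector_mult_def vec_eq_iff scaleR_right.sum)

lemma inj_unitary_matrix:
  fixes P :: "complex^'n^'n"
  assumes "unitary_matrix P"
  shows "inj ((*v) P)"
proof -
  obtain Q where "Q ** P = mat 1"
    using assms by (auto simp: unitary_matrix_def Let_def)
  then have "Q *v (P *v x) = x" for x
    by (simp add: matrix_vector_mul_assoc)
  then show ?thesis by (metis injI)
qed

text \<open>For \<open>\<gamma> > 1\<close> the constants in the bounds only shift the exponent by a
  multiple of \<open>1 / ln \<gamma>\<close>, which vanishes in the limit.\<close>

lemma outage_exponent_of_bounds:
  fixes p :: "real \<Rightarrow> real"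
  assumes c: "0 < c" and lower: "\<And>\<gamma>. 1 \<le> \<gamma> \<Longrightarrow> c / \<gamma> ^ n \<le> p \<gamma>"
    and upper: "\<And>\<gamma>. 1 \<le> \<gamma> \<Longrightarrow> p \<gamma> \<le> K / \<gamma> ^ n"
  shows "((\<lambda>\<gamma>. - (ln (p \<gamma>) / ln \<gamma>)) \<longlongrightarrow> real n) at_top"
proof (rule tendsto_sandwich)
  \<comment> \<open>Positivity of \<open>K\<close> is obtained by comparing the two bounds at
    \<open>\<gamma> = 1\<close>.\<close>
  have "c \<le> K" using lower[of 1] upper[of 1] by simp
  with c have K: "0 < K" by simp
  have lim: "((\<lambda>\<gamma>. n - ln d / ln \<gamma>) \<longlongrightarrow> real n) at_top" for d :: real
    by real_asymp
  show "((\<lambda>\<gamma>. n - ln K / ln \<gamma>) \<longlongrightarrow> real n) at_top" "((\<lambda>\<gamma>. n - ln c / ln \<gamma>) \<longlongrightarrow> real n) at_top"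
    by (rule lim)+
  have ln_div_pow: "ln (d / \<gamma> ^ n) = ln d - n * ln \<gamma>" if "0 < d" "1 < \<gamma>" for d \<gamma> :: real
    using that by (simp add: ln_div ln_realpow)
  show "\<forall>\<^sub>F \<gamma> in at_top. n - ln K / ln \<gamma> \<le> - (ln (p \<gamma>) / ln \<gamma>)"
    using eventually_gt_at_top[of 1]
  proof eventually_elim
    case (elim \<gamma>)
    have "0 < c / \<gamma> ^ n" using c elim by simp
    then have "ln (p \<gamma>) \<le> ln (K / \<gamma> ^ n)"
      using lower[of \<gamma>] upper[of \<gamma>] elim by (subst ln_le_cancel_iff) auto
    then have "ln (p \<gamma>) / ln \<gamma> \<le> ln (K / \<gamma> ^ n) / ln \<gamma>"
      using elim by (intro divide_right_mono) auto
    then show ?case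
      using elim K by (simp add: ln_div_pow diff_divide_distrib)
  qed
  show "\<forall>\<^sub>F \<gamma> in at_top. - (ln (p \<gamma>) / ln \<gamma>) \<le> n - ln c / ln \<gamma>"
    using eventually_gt_at_top[of 1]
  proof eventually_elim
    case (elim \<gamma>)
    have "0 < c / \<gamma> ^ n" using c elim by simp
    then have "ln (c / \<gamma> ^ n) \<le> ln (p \<gamma>)"
      using lower[of \<gamma>] elim by (subst ln_le_cancel_iff) auto
    then have "ln (c / \<gamma> ^ n) / ln \<gamma> \<le> ln (p \<gamma>) / ln \<gamma>"
      using elim by (intro divide_right_mono) auto
    then show ?case
      using elim c by (simp add: ln_div_pow diff_divide_distrib)
  qed
qed

section \<open>The finite set of input vectors before precoding\<close>

text \<open>One membership condition per coordinate makes this set the image of a finite product of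
  sets, from which its cardinality is read off.\<close>

definition codebook :: "complex set \<Rightarrow> 'n set \<Rightarrow> (complex^'n) set" where
  "codebook C J = {\<zeta>. \<forall>j. \<zeta> $ j \<in> (if j \<in> J then C else {0})}"

lemma codebook_nth_mem: "\<zeta> \<in> codebook C J \<Longrightarrow> j \<in> J \<Longrightarrow> \<zeta> $ j \<in> C"
  unfolding codebook_def by (metis (mono_tags, lifting) mem_Collect_eq)

lemma codebook_eq: "codebook C J = vec_lambda ` (\<Pi>\<^sub>E j\<in>UNIV. if j \<in> J then C else {0})"
proof (intro equalityI subsetI)
  fix \<zeta> assume "\<zeta> \<in> codebook C J"
  then have "vec_nth \<zeta> \<in> (\<Pi>\<^sub>E j\<in>UNIV. if j \<in> J then C else {0})"
    by (simp add: codebook_def PiE_iff)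
  then show "\<zeta> \<in> vec_lambda ` (\<Pi>\<^sub>E j\<in>UNIV. if j \<in> J then C else {0})"
    by (metis image_eqI vec_nth_inverse)
next
  fix \<zeta> assume "\<zeta> \<in> vec_lambda ` (\<Pi>\<^sub>E j\<in>UNIV. if j \<in> J then C else {0})"
  then obtain f where "f \<in> (\<Pi>\<^sub>E j\<in>UNIV. if j \<in> J then C else {0})" "\<zeta> = vec_lambda f" by blast
  then show "\<zeta> \<in> codebook C J"
    by (simp add: codebook_def PiE_iff split del: if_split)
qed

lemma card_codebook: "card (codebook C (J :: 'n::finite set)) = card C ^ card J"
proof -
  have "inj_on vec_lambda (\<Pi>\<^sub>E j\<in>(UNIV::'n set). if j \<in> J then C else {0})"
    by (auto simp: inj_on_def vec_eq_iff)
  then have "card (codebook C J) = (\<Prod>j\<in>UNIV. card (if j \<in> J then C else {0}))"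
    unfolding codebook_eq by (simp add: card_image card_PiE)
  also have "\<dots> = (\<Prod>j\<in>UNIV. if j \<in> J then card C else 1)"
    by (intro prod.cong) auto
  also have "\<dots> = card C ^ card J"
    by (simp add: prod.If_cases)
  finally show ?thesis .
qed

lemma finite_codebook: "finite C \<Longrightarrow> finite (codebook C J)"
  unfolding codebook_eq by (intro finite_imageI finite_PiE) auto

lemma codebook_ne: "finite C \<Longrightarrow> C \<noteq> {} \<Longrightarrow> codebook C (J :: 'n::finite set) \<noteq> {}"
  using card_codebook[of C J] by (auto simp: card_gt_0_iff)

section \<open>Laws of the channel, the noise and the input\<close>

context mimo_channel
begin

text \<open>
  \<open>J\<close> and \<open>k\<close> are fixed by equations because local definitions of them would take the type \<open>'r\<close>
  as an extra argument.
\<close>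

context
  fixes J :: "'t set" and k :: real
  assumes J: "J = first_indices (min CARD('t) CARD('r))"
    and k: "k = (1 / pi) ^ CARD('r)"
    and finite_C: "finite C" and C_ne: "C \<noteq> {}"
begin

lemma card_J: "card J = min CARD('t) CARD('r)"
  unfolding J by (simp add: card_first_indices)

lemma measurable_channel[measurable]: "H \<in> borel_measurable \<Omega>"
  using channel_distr by (intro borel_measurable_vecI) (auto simp: distributed_def)

lemma distributed_noise:
  "distributed \<Omega> lborel w (\<lambda>y. ennreal (k * exp (- (norm y)\<^sup>2)))"
proof -
  have "(\<Prod>i\<in>UNIV. ennreal (complex_normal_density (y $ i))) =
      ennreal (k * exp (- (norm y)\<^sup>2))" for y :: "complex^'r"
    unfolding k prod_complex_normal_density[symmetric]
    by (intro prod_ennreal) (simp add: complex_normal_density_def)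
  then show ?thesis
    using distributed_vec[OF noise_indep noise_distr] by simp
qed

lemma measurable_noise[measurable]: "w \<in> borel_measurable \<Omega>"
  using distributed_noise by (auto simp: distributed_def)

text \<open>The total mass 1 is read off from the noise law being a probability measure. The centres
  are not mentioned, so the fact serves for every \<open>\<gamma>\<close> and every channel
  matrix.\<close>

lemma gaussian_mixture_output:
  assumes "finite S" "S \<noteq> {}"
  shows "gaussian_mixture TYPE(complex^'r) S k"
proof
  show "0 < k" by (simp add: k)
  let ?g = "\<lambda>y :: complex^'r. k * exp (- (norm y)\<^sup>2)"
  interpret w: prob_space "distr \<Omega> borel w" by (rule prob_space_distr) simp
  have "distr \<Omega> borel w = density lborel (\<lambda>y. ennreal (?g y))"
    using distributed_noise by (simp add: distributed_def cong: distr_cong)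
  then have "(\<integral>\<^sup>+y. ennreal (?g y) \<partial>lborel) = ennreal 1"
    using w.emeasure_space_1 by (simp add: emeasure_density)
  then show "has_bochner_integral lborel ?g 1"
    by (intro has_bochner_integral_nn_integral) (auto simp: k)
qed (use assms in auto)

lemma measurable_input_component: "(\<lambda>\<omega>. z \<omega> $ j) \<in> borel_measurable \<Omega>"
proof (cases "j \<in> J")
  case True
  then have "(\<lambda>\<omega>. z \<omega> $ j) \<in> \<Omega> \<rightarrow>\<^sub>M count_space C"
    using input_uniform J by (auto simp: distributed_def)
  from measurable_compose[OF this, of "\<lambda>x. x" borel] show ?thesis by simp
next
  case False
  then show ?thesis
    using input_zero False J by (subst measurable_cong[where g="\<lambda>_. 0"]) auto
qed

lemma measurable_input[measurable]: "z \<in> borel_measurable \<Omega>"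
  by (intro borel_measurable_vecI measurable_input_component)

lemma prob_input_component:
  assumes j: "j \<in> J" and c: "c \<in> C"
  shows "prob ((\<lambda>\<omega>. z \<omega> $ j) -` {c} \<inter> space \<Omega>) = 1 / card C"
proof -
  have zj: "(\<lambda>\<omega>. z \<omega> $ j) \<in> \<Omega> \<rightarrow>\<^sub>M count_space C"
    and law: "distr \<Omega> (count_space C) (\<lambda>\<omega>. z \<omega> $ j) = density (count_space C) (\<lambda>_. ennreal (1 / card C))"
    using input_uniform[of j] j J by (auto simp: distributed_def)
  have "emeasure \<Omega> ((\<lambda>\<omega>. z \<omega> $ j) -` {c} \<inter> space \<Omega>) =
      emeasure (distr \<Omega> (count_space C) (\<lambda>\<omega>. z \<omega> $ j)) {c}"
    using c zj by (simp add: emeasure_distr)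
  also have "\<dots> = ennreal (1 / card C)"
    unfolding law using c by (simp add: emeasure_density_const)
  finally show ?thesis by (simp add: emeasure_eq_measure)
qed

lemma prob_input:
  assumes \<zeta>: "\<zeta> \<in> codebook C J"
  shows "prob {\<omega> \<in> space \<Omega>. z \<omega> = \<zeta>} = 1 / card (codebook C J)"
proof -
  \<comment> \<open>Both antenna numbers are positive. An empty index set would make the
    intersection below the whole type instead of \<open>space \<Omega>\<close>.\<close>
  have ne: "J \<noteq> {}"
    using card_J by (metis card.empty min_less_iff_conj not_less_zero zero_less_card_finite)
  have "{\<omega> \<in> space \<Omega>. z \<omega> = \<zeta>} = (\<Inter>j\<in>J. (\<lambda>\<omega>. z \<omega> $ j) -` {\<zeta> $ j} \<inter> space \<Omega>)"
  proof (intro equalityI subsetI)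
    fix \<omega> assume *: "\<omega> \<in> (\<Inter>j\<in>J. (\<lambda>\<omega>. z \<omega> $ j) -` {\<zeta> $ j} \<inter> space \<Omega>)"
    with ne have \<omega>: "\<omega> \<in> space \<Omega>" by auto
    have "z \<omega> $ j = \<zeta> $ j" for j
    proof (cases "j \<in> J")
      case True
      then show ?thesis using * ne by auto
    next
      case False
      moreover have "\<zeta> $ j \<in> (if j \<in> J then C else {0})"
        using \<zeta> by (simp add: codebook_def)
      ultimately show ?thesis
        using input_zero[OF _ \<omega>, of j] by (simp add: J)
    qed
    with \<omega> show "\<omega> \<in> {\<omega> \<in> space \<Omega>. z \<omega> = \<zeta>}" by (simp add: vec_eq_iff)
  qed (use ne in auto)
  also have "prob \<dots> = (\<Prod>j\<in>J. prob ((\<lambda>\<omega>. z \<omega> $ j) -` {\<zeta> $ j} \<inter> space \<Omega>))"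
    using \<zeta> ne by (intro indep_varsD_finite[OF input_indep[folded J]]) (auto simp: codebook_nth_mem)
  also have "\<dots> = (\<Prod>j\<in>J. 1 / card C)"
    using \<zeta> by (intro prod.cong refl prob_input_component) (auto simp: codebook_nth_mem)
  also have "\<dots> = 1 / card (codebook C J)"
    by (simp add: card_codebook card_J power_one_over)
  finally show ?thesis .
qed

text \<open>Projecting the product law of the triple to its last two components gives independence
  of \<open>z\<close> and \<open>w\<close>, which survives applying \<open>f\<close> to
  \<open>z\<close>.\<close>

lemma joint_law_input_noise:
  assumes [measurable]: "f \<in> borel_measurable borel"
  shows "distr \<Omega> (borel \<Otimes>\<^sub>M borel) (\<lambda>\<omega>. (f (z \<omega>) :: complex^('t::{finite,linorder}), w \<omega>)) =
    distr \<Omega> borel (\<lambda>\<omega>. f (z \<omega>)) \<Otimes>\<^sub>M distr \<Omega> borel w"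
proof -
  let ?B = "distr \<Omega> borel z \<Otimes>\<^sub>M distr \<Omega> borel w"
  interpret z: prob_space "distr \<Omega> borel z" by (rule prob_space_distr) simp
  interpret w: prob_space "distr \<Omega> borel w" by (rule prob_space_distr) simp
  interpret zw: pair_prob_space "distr \<Omega> borel z" "distr \<Omega> borel w" ..
  have sets_B: "sets ?B = sets (borel \<Otimes>\<^sub>M borel)" by (intro sets_pair_measure_cong) auto
  have "distr \<Omega> (borel \<Otimes>\<^sub>M borel) (\<lambda>\<omega>. (z \<omega>, w \<omega>)) =
      distr (distr \<Omega> (borel \<Otimes>\<^sub>M (borel \<Otimes>\<^sub>M borel)) (\<lambda>\<omega>. (H \<omega>, z \<omega>, w \<omega>))) (borel \<Otimes>\<^sub>M borel) snd"
    by (subst distr_distr) (auto simp: comp_def)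
  also have "\<dots> = distr (distr \<Omega> borel H \<Otimes>\<^sub>M ?B) ?B snd"
    unfolding channel_input_noise_indep by (intro distr_cong) (auto simp: sets_B)
  also have "\<dots> = ?B"
    by (intro distr_pair_snd prob_space_distr zw.prob_space_axioms) simp
  finally have zw: "distr \<Omega> (borel \<Otimes>\<^sub>M borel) (\<lambda>\<omega>. (z \<omega>, w \<omega>)) = ?B" .
  have "distr \<Omega> (borel \<Otimes>\<^sub>M borel) (\<lambda>\<omega>. (f (z \<omega>), w \<omega>)) =
      distr (distr \<Omega> (borel \<Otimes>\<^sub>M borel) (\<lambda>\<omega>. (z \<omega>, w \<omega>))) (borel \<Otimes>\<^sub>M borel) (\<lambda>(x, y). (f x, y))"
    by (subst distr_distr) (auto simp: comp_def)
  also have "\<dots> = distr (distr \<Omega> borel z) borel f \<Otimes>\<^sub>M distr (distr \<Omega> borel w) borel (\<lambda>x. x)"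
    unfolding zw by (rule pair_measure_distr[symmetric])
      (auto intro!: prob_space_imp_sigma_finite w.prob_space_distr)
  also have "\<dots> = distr \<Omega> borel (\<lambda>\<omega>. f (z \<omega>)) \<Otimes>\<^sub>M distr \<Omega> borel w"
    by (subst (1 2) distr_distr) (auto simp: comp_def)
  finally show ?thesis .
qed

section \<open>Transmitted signals and the outage event for a fixed precoder\<close>

context
  fixes P :: "complex^('t::{finite,linorder})^('t::{finite,linorder})"
  assumes P: "unitary_matrix P"
begin

definition signals :: "(complex^('t::{finite,linorder})) set" where
  "signals = (*v) P ` codebook C J"

lemma finite_signals: "finite signals"
  and signals_ne: "signals \<noteq> {}"
  and card_signals: "card signals = card C ^ card J"
  using finite_codebook[OF finite_C] codebook_ne[OF finite_C C_ne] inj_on_subset[OF inj_unitary_matrix[OF P]]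
  by (auto simp: signals_def card_image card_codebook)

definition output_equivocation :: "real \<Rightarrow> complex^('t::{finite,linorder})^'r \<Rightarrow> real" where
  "output_equivocation \<gamma> h =
    gaussian_mixture.equivocation signals k (\<lambda>x. sqrt \<gamma> *\<^sub>R (h *v x))"

lemma measurable_precoder[measurable]: "(*v) P \<in> borel_measurable borel"
  by (intro borel_measurable_continuous_onI linear_continuous_on)
     (simp add: linear_conv_bounded_linear[symmetric] linear_iff matrix_vector_right_distrib matrix_vector_mult_scaleR_right)

text \<open>A unitary precoder is injective, so it carries the uniform law on the codebook to the
  uniform law on its image.\<close>

lemma distr_signal: "distr \<Omega> borel (\<lambda>\<omega>. P *v z \<omega>) = distr (measure_pmf (pmf_of_set signals)) borel (\<lambda>x. x)"
proof (rule distr_pmf_of_set)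
  fix x assume "x \<in> signals"
  then obtain \<zeta> where \<zeta>: "\<zeta> \<in> codebook C J" "x = P *v \<zeta>" by (auto simp: signals_def)
  have "{\<omega> \<in> space \<Omega>. P *v z \<omega> = x} = {\<omega> \<in> space \<Omega>. z \<omega> = \<zeta>}"
    using inj_unitary_matrix[OF P] by (auto simp: \<zeta> inj_eq)
  then show "prob {\<omega> \<in> space \<Omega>. P *v z \<omega> = x} = 1 / card signals"
    using prob_input[OF \<zeta>(1)] by (simp add: card_signals card_codebook)
qed (use finite_signals signals_ne prob_space_axioms in auto)

lemma realization_mutual_information_eq:
  "realization_mutual_information \<Omega> P z w \<gamma> h =
    log 2 (card signals) - output_equivocation \<gamma> h / ln 2"
proof -
  interpret G: gaussian_mixture signals k "\<lambda>x. sqrt \<gamma> *\<^sub>R (h *v x)"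
    by (rule gaussian_mixture_output[OF finite_signals signals_ne])
  show ?thesis
    unfolding realization_mutual_information_def received_def output_equivocation_def
    by (rule G.mutual_information_eq)
       (auto intro!: prob_space_axioms distr_signal joint_law_input_noise distributed_noise
         borel_measurable_continuous_onI linear_continuous_on
         simp: linear_conv_bounded_linear[symmetric] linear_iff matrix_vector_right_distrib
           matrix_vector_mult_scaleR_right algebra_simps)
qed

lemma measurable_output_equivocation[measurable]: "output_equivocation \<gamma> \<in> borel_measurable borel"
proof -
  note borel_measurable_matrix_vector_mult[measurable]
  interpret G: gaussian_mixture signals k "\<lambda>x. sqrt \<gamma> *\<^sub>R (h *v x)" for h :: "complex^('t::{finite,linorder})^'r"
    by (rule gaussian_mixture_output[OF finite_signals signals_ne])
  show ?thesis
    unfolding output_equivocation_def G.equivocation_def G.loss_def G.mix_def G.bump_def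
    by measurable
qed

text \<open>The number of coded bits per channel use is the binary logarithm of the number of
  signals. Outage thus means that the equivocation exceeds the fraction \<open>1 - R\<^sub>c\<close>
  of the input entropy.\<close>

lemma outage_iff:
  assumes "card C \<ge> 2"
  shows "realization_mutual_information \<Omega> P z w \<gamma> h < real (min CARD('t) CARD('r)) * log 2 (card C) * R\<^sub>c \<longleftrightarrow>
    (1 - R\<^sub>c) * ln (card signals) < output_equivocation \<gamma> h"
proof -
  have "real (min CARD('t) CARD('r)) * log 2 (card C) = ln (card signals) / ln 2"
    using assms by (simp add: card_signals card_J log_def ln_realpow)
  moreover have "log 2 (card signals) - output_equivocation \<gamma> h / ln 2 =
      (ln (card signals) - output_equivocation \<gamma> h) / ln 2"
    by (simp add: log_def diff_divide_distrib)
  ultimately show ?thesis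
    unfolding realization_mutual_information_eq
    by (simp add: divide_less_cancel algebra_simps)
qed

lemma outage_upper:
  assumes C2: "card C \<ge> 2" and R: "R\<^sub>c < 1"
  shows "\<exists>K. \<forall>\<gamma>\<ge>1. outage_probability \<Omega> P H z w (real (min CARD('t) CARD('r)) * log 2 (card C) * R\<^sub>c) \<gamma>
    \<le> K / \<gamma> ^ CARD('r)"
proof -
  let ?N = "card signals"
  have N: "1 < ?N"
    unfolding card_signals using C2 by (intro one_less_power) (auto simp: card_J)
  define \<delta> where "\<delta> = (1 - R\<^sub>c) * ln ?N"
  have \<delta>: "0 < \<delta>" using N R by (simp add: \<delta>_def)
  \<comment> \<open>A separation \<open>A\<close> is chosen that pushes the equivocation below the
    outage threshold. It depends on the rate but not on \<open>\<gamma>\<close>.\<close>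
  have "((\<lambda>A. 2 * ?N * exp (- A\<^sup>2 / 4)) \<longlongrightarrow> 0) at_top"
    by real_asymp
  then have "\<forall>\<^sub>F A in at_top. 2 * ?N * exp (- A\<^sup>2 / 4) < \<delta>"
    using \<delta> by (rule order_tendstoD)
  then have "\<forall>\<^sub>F A in at_top. 0 \<le> A \<and> 2 * ?N * exp (- A\<^sup>2 / 4) < \<delta>"
    using eventually_ge_at_top[of 0] by eventually_elim simp
  then obtain A where A: "0 \<le> A" "2 * ?N * exp (- A\<^sup>2 / 4) < \<delta>"
    by (auto simp: eventually_at_top_linorder)
  \<comment> \<open>Finitely many nonzero differences of signals, over which the union bound is
    taken.\<close>
  define D where "D = (\<lambda>(x, x'). x - x') ` {(x, x'). x \<in> signals \<and> x' \<in> signals \<and> x \<noteq> x'}"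
  have "finite {(x, x'). x \<in> signals \<and> x' \<in> signals \<and> x \<noteq> x'}"
    by (rule finite_subset[OF _ finite_cartesian_product[OF finite_signals finite_signals]]) auto
  then have finite_D: "finite D" by (simp add: D_def)
  have "\<forall>v\<in>D. \<exists>K. \<forall>\<epsilon>\<ge>0. prob {\<omega> \<in> space \<Omega>. \<forall>i. cmod ((H \<omega> *v v) $ i) \<le> \<epsilon>} \<le> K * (\<epsilon>\<^sup>2) ^ CARD('r)"
  proof
    fix v assume "v \<in> D"
    then have "v \<noteq> 0" by (auto simp: D_def)
    from channel_small_ball_upper[OF channel_indep channel_distr this]
    show "\<exists>K. \<forall>\<epsilon>\<ge>0. prob {\<omega> \<in> space \<Omega>. \<forall>i. cmod ((H \<omega> *v v) $ i) \<le> \<epsilon>} \<le> K * (\<epsilon>\<^sup>2) ^ CARD('r)"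
      by blast
  qed
  then obtain K where K: "\<And>v \<epsilon>. v \<in> D \<Longrightarrow> 0 \<le> \<epsilon> \<Longrightarrow>
      prob {\<omega> \<in> space \<Omega>. \<forall>i. cmod ((H \<omega> *v v) $ i) \<le> \<epsilon>} \<le> K v * (\<epsilon>\<^sup>2) ^ CARD('r)"
    by (subst (asm) bchoice_iff) blast
  show ?thesis
  proof (intro exI allI impI)
    fix \<gamma> :: real assume \<gamma>: "1 \<le> \<gamma>"
    let ?E = "\<lambda>v. {\<omega> \<in> space \<Omega>. \<forall>i. cmod ((H \<omega> *v v) $ i) \<le> A / sqrt \<gamma>}"
    note borel_measurable_matrix_vector_mult[measurable]
    have [measurable]: "(\<lambda>y::complex^'r. y $ i) \<in> borel_measurable borel" for i
      by (intro borel_measurable_continuous_onI continuous_intros)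
    have E: "?E v \<in> sets \<Omega>" for v by measurable
    have sub: "{\<omega> \<in> space \<Omega>. \<delta> < output_equivocation \<gamma> (H \<omega>)} \<subseteq> (\<Union>v\<in>D. ?E v)"
    proof
      fix \<omega> assume \<omega>: "\<omega> \<in> {\<omega> \<in> space \<Omega>. \<delta> < output_equivocation \<gamma> (H \<omega>)}"
      interpret G: gaussian_mixture signals k "\<lambda>x. sqrt \<gamma> *\<^sub>R (H \<omega> *v x)"
        by (rule gaussian_mixture_output[OF finite_signals signals_ne])
      have "\<not> (\<forall>x\<in>signals. \<forall>x'\<in>signals. x \<noteq> x' \<longrightarrow> A \<le> norm (sqrt \<gamma> *\<^sub>R (H \<omega> *v x) - sqrt \<gamma> *\<^sub>R (H \<omega> *v x')))"
      proof
        assume "\<forall>x\<in>signals. \<forall>x'\<in>signals. x \<noteq> x' \<longrightarrow> A \<le> norm (sqrt \<gamma> *\<^sub>R (H \<omega> *v x) - sqrt \<gamma> *\<^sub>R (H \<omega> *v x'))"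
        then have "G.equivocation \<le> 2 * ?N * exp (- A\<^sup>2 / 4)"
          using A by (intro G.equivocation_le) auto
        with A \<omega> show False by (simp add: output_equivocation_def)
      qed
      then obtain x x' where x: "x \<in> signals" "x' \<in> signals" "x \<noteq> x'"
        "norm (sqrt \<gamma> *\<^sub>R (H \<omega> *v x) - sqrt \<gamma> *\<^sub>R (H \<omega> *v x')) < A"
        by (auto simp: not_le)
      then have "sqrt \<gamma> * norm (H \<omega> *v (x - x')) < A"
        using \<gamma> by (simp add: scaleR_diff_right[symmetric] matrix_vector_mult_diff_distrib)
      then have "norm (H \<omega> *v (x - x')) \<le> A / sqrt \<gamma>"
        using \<gamma> by (simp add: field_simps)
      then have "cmod ((H \<omega> *v (x - x')) $ i) \<le> A / sqrt \<gamma>" for i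
        using Finite_Cartesian_Product.norm_nth_le order_trans by blast
      moreover have "x - x' \<in> D" using x by (auto simp: D_def)
      ultimately show "\<omega> \<in> (\<Union>v\<in>D. ?E v)" using \<omega> by blast
    qed
    have "outage_probability \<Omega> P H z w (real (min CARD('t) CARD('r)) * log 2 (card C) * R\<^sub>c) \<gamma> =
        prob {\<omega> \<in> space \<Omega>. \<delta> < output_equivocation \<gamma> (H \<omega>)}"
      unfolding outage_probability_def outage_iff[OF C2] \<delta>_def ..
    also have "\<dots> \<le> prob (\<Union>v\<in>D. ?E v)"
      using sub finite_D E by (intro finite_measure_mono) auto
    also have "\<dots> \<le> (\<Sum>v\<in>D. prob (?E v))"
      using finite_D E by (intro finite_measure_subadditive_finite) auto
    also have "\<dots> \<le> (\<Sum>v\<in>D. K v * ((A / sqrt \<gamma>)\<^sup>2) ^ CARD('r))"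
      using A \<gamma> by (intro sum_mono K) auto
    also have "\<dots> = (\<Sum>v\<in>D. K v) * (A\<^sup>2) ^ CARD('r) / \<gamma> ^ CARD('r)"
      using \<gamma> by (simp add: sum_distrib_right sum_divide_distrib power_divide)
    finally show "outage_probability \<Omega> P H z w (real (min CARD('t) CARD('r)) * log 2 (card C) * R\<^sub>c) \<gamma> \<le>
      (\<Sum>v\<in>D. K v) * (A\<^sup>2) ^ CARD('r) / \<gamma> ^ CARD('r)" .
  qed
qed

lemma outage_lower:
  assumes C2: "card C \<ge> 2"
  shows "\<exists>R\<^sub>0. 0 < R\<^sub>0 \<and> R\<^sub>0 < 1 \<and> (\<exists>c>0. \<forall>R\<^sub>c>R\<^sub>0. \<forall>\<gamma>\<ge>1. c / \<gamma> ^ CARD('r) \<le>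
    outage_probability \<Omega> P H z w (real (min CARD('t) CARD('r)) * log 2 (card C) * R\<^sub>c) \<gamma>)"
proof -
  let ?N = "card signals"
  have N: "1 < ?N"
    unfolding card_signals using C2 by (intro one_less_power) (auto simp: card_J)
  then have ln_N: "0 < ln ?N" by simp
  interpret G: gaussian_mixture signals k "\<lambda>x. sqrt \<gamma> *\<^sub>R (h *v x)" for \<gamma> and h :: "complex^('t::{finite,linorder})^'r"
    by (rule gaussian_mixture_output[OF finite_signals signals_ne])
  \<comment> \<open>Above the second term, \<open>(1 - R\<^sub>c) * ln ?N\<close> is smaller than
    the gap constant; the maximum with 1/2 secures positivity.\<close>
  define R\<^sub>0 where "R\<^sub>0 = max (1 / 2) (1 - G.gap_constant / ln ?N)"
  have R\<^sub>0: "0 < R\<^sub>0" "R\<^sub>0 < 1"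
    using G.gap_constant_pos ln_N by (auto simp: R\<^sub>0_def)
  obtain x x' where x: "x \<in> signals" "x' \<in> signals" "x \<noteq> x'"
    using N by (metis One_nat_def card_le_Suc0_iff_eq finite_signals not_less)
  then have "x - x' \<noteq> 0" by simp
  from channel_small_ball_lower[OF channel_indep channel_distr this]
  obtain c where c: "0 < c" "\<And>\<epsilon>. 0 \<le> \<epsilon> \<Longrightarrow> \<epsilon> \<le> 1 \<Longrightarrow>
      c * (\<epsilon>\<^sup>2) ^ CARD('r) \<le> prob {\<omega> \<in> space \<Omega>. \<forall>i. cmod ((H \<omega> *v (x - x')) $ i) \<le> \<epsilon>}"
    by blast
  define c' where "c' = c * ((1 / real CARD('r))\<^sup>2) ^ CARD('r)"
  have bound: "c' / \<gamma> ^ CARD('r) \<le>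
      outage_probability \<Omega> P H z w (real (min CARD('t) CARD('r)) * log 2 (card C) * R\<^sub>c) \<gamma>"
    if R\<^sub>c: "R\<^sub>0 < R\<^sub>c" and \<gamma>: "1 \<le> \<gamma>" for R\<^sub>c \<gamma>
  proof -
    \<comment> \<open>The norm is at most the sum of the \<open>CARD('r)\<close> component moduli,
      so this radius forces the two noiseless outputs to within distance 1. For
      \<open>\<gamma> \<ge> 1\<close> it does not exceed 1.\<close>
    define \<epsilon> where "\<epsilon> = 1 / (real CARD('r) * sqrt \<gamma>)"
    have r: "1 \<le> real CARD('r)" by (simp add: Suc_le_eq)
    have "1 * 1 \<le> real CARD('r) * sqrt \<gamma>"
      using r \<gamma> by (intro mult_mono) auto
    then have \<epsilon>: "0 \<le> \<epsilon>" "\<epsilon> \<le> 1" by (auto simp: \<epsilon>_def)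
    have "(1 - R\<^sub>c) * ln ?N < G.gap_constant"
    proof -
      have "1 - G.gap_constant / ln ?N < R\<^sub>c" using R\<^sub>c by (simp add: R\<^sub>0_def)
      then show ?thesis using ln_N by (simp add: field_simps)
    qed
    then have sub: "{\<omega> \<in> space \<Omega>. \<forall>i. cmod ((H \<omega> *v (x - x')) $ i) \<le> \<epsilon>} \<subseteq>
        {\<omega> \<in> space \<Omega>. (1 - R\<^sub>c) * ln ?N < output_equivocation \<gamma> (H \<omega>)}"
    proof (intro subsetI CollectI conjI)
      fix \<omega> assume gap: "(1 - R\<^sub>c) * ln ?N < G.gap_constant"
        and \<omega>: "\<omega> \<in> {\<omega> \<in> space \<Omega>. \<forall>i. cmod ((H \<omega> *v (x - x')) $ i) \<le> \<epsilon>}"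
      have "norm (H \<omega> *v (x - x')) \<le> (\<Sum>i\<in>UNIV. cmod ((H \<omega> *v (x - x')) $ i))"
        unfolding norm_vec_def by (intro L2_set_le_sum) auto
      also have "\<dots> \<le> real CARD('r) * \<epsilon>"
        using \<omega> by (intro sum_bounded_above) auto
      also have "\<dots> = 1 / sqrt \<gamma>" by (simp add: \<epsilon>_def)
      finally have "sqrt \<gamma> * norm (H \<omega> *v (x - x')) \<le> 1"
        using \<gamma> by (simp add: field_simps)
      then have "norm (sqrt \<gamma> *\<^sub>R (H \<omega> *v x) - sqrt \<gamma> *\<^sub>R (H \<omega> *v x')) \<le> 1"
        using \<gamma> by (simp add: scaleR_diff_right[symmetric] matrix_vector_mult_diff_distrib)
      then have "G.gap_constant \<le> output_equivocation \<gamma> (H \<omega>)"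
        unfolding output_equivocation_def by (rule G.equivocation_ge[OF x])
      with gap show "(1 - R\<^sub>c) * ln ?N < output_equivocation \<gamma> (H \<omega>)" by simp
    qed simp
    have "c' / \<gamma> ^ CARD('r) = c * (\<epsilon>\<^sup>2) ^ CARD('r)"
      using \<gamma> by (simp add: c'_def \<epsilon>_def power_divide power_mult_distrib)
    also have "\<dots> \<le> prob {\<omega> \<in> space \<Omega>. \<forall>i. cmod ((H \<omega> *v (x - x')) $ i) \<le> \<epsilon>}"
      using \<epsilon> by (rule c(2))
    also have "\<dots> \<le> prob {\<omega> \<in> space \<Omega>. (1 - R\<^sub>c) * ln ?N < output_equivocation \<gamma> (H \<omega>)}"
      by (intro finite_measure_mono sub) measurable
    also have "\<dots> = outage_probability \<Omega> P H z w (real (min CARD('t) CARD('r)) * log 2 (card C) * R\<^sub>c) \<gamma>"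
      unfolding outage_probability_def outage_iff[OF C2] ..
    finally show ?thesis .
  qed
  moreover have "0 < c'" using c by (simp add: c'_def)
  ultimately show ?thesis using R\<^sub>0 by blast
qed

end

end

end

theorem lemma4:
  fixes \<Omega> :: "'a measure"
    and H :: "'a \<Rightarrow> complex^('t :: {finite, linorder})^('r :: finite)"
    and z :: "'a \<Rightarrow> complex^('t :: {finite, linorder})"
    and w :: "'a \<Rightarrow> complex^'r"
    and P :: "complex^('t :: {finite, linorder})^('t :: {finite, linorder})"
    and C :: "complex set"
    and q :: nat
  assumes "mimo_channel \<Omega> C H z w"
    and "unitary_matrix P"
    and "q \<ge> 1"
    and "card C = 2 ^ q"
    and "(\<Sum>c\<in>C. (cmod c)\<^sup>2) / card C =
           (if CARD('r) \<ge> CARD('t) then 1 else real CARD('t) / real CARD('r))"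
  shows "\<exists>R\<^sub>0. 0 < R\<^sub>0 \<and> R\<^sub>0 < 1 \<and>
           (\<forall>R\<^sub>c. R\<^sub>0 < R\<^sub>c \<and> R\<^sub>c < 1 \<longrightarrow>
              ((\<lambda>\<gamma>. - (ln (outage_probability \<Omega> P H z w
                           (real (min CARD('t) CARD('r)) * log 2 (card C) * R\<^sub>c) \<gamma>) / ln \<gamma>))
                \<longlongrightarrow> real CARD('r)) at_top)"
proof -
  interpret mimo_channel \<Omega> C H z w by fact
  have "(2::nat) ^ 1 \<le> 2 ^ q" using \<open>q \<ge> 1\<close> by (intro power_increasing) auto
  with assms(4) have C2: "card C \<ge> 2" by simp
  \<comment> \<open>An infinite set has \<open>card\<close> equal to 0, so the bound on
    \<open>card C\<close> also yields finiteness.\<close>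
  then have C: "finite C" "C \<noteq> {}" using card.infinite by fastforce+
  note P = \<open>unitary_matrix P\<close>
  obtain R\<^sub>0 c where R\<^sub>0: "0 < R\<^sub>0" "R\<^sub>0 < 1" and c: "0 < c"
    and lower: "\<And>R\<^sub>c \<gamma>. R\<^sub>0 < R\<^sub>c \<Longrightarrow> 1 \<le> \<gamma> \<Longrightarrow> c / \<gamma> ^ CARD('r) \<le>
      outage_probability \<Omega> P H z w (real (min CARD('t) CARD('r)) * log 2 (card C) * R\<^sub>c) \<gamma>"
    using outage_lower[OF refl refl C P C2] by auto
  show ?thesis
  proof (intro exI conjI allI impI)
    fix R\<^sub>c assume R\<^sub>c: "R\<^sub>0 < R\<^sub>c \<and> R\<^sub>c < 1"
    \<comment> \<open>\<open>K\<close> may depend on the rate, because the limit is taken for each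
      rate separately.\<close>
    obtain K where "\<And>\<gamma>. 1 \<le> \<gamma> \<Longrightarrow>
        outage_probability \<Omega> P H z w (real (min CARD('t) CARD('r)) * log 2 (card C) * R\<^sub>c) \<gamma> \<le> K / \<gamma> ^ CARD('r)"
      using outage_upper[OF refl refl C P C2] R\<^sub>c by blast
    with lower R\<^sub>c c show "((\<lambda>\<gamma>. - (ln (outage_probability \<Omega> P H z w
        (real (min CARD('t) CARD('r)) * log 2 (card C) * R\<^sub>c) \<gamma>) / ln \<gamma>)) \<longlongrightarrow> real CARD('r)) at_top"
      by (intro outage_exponent_of_bounds) auto
  qed (use R\<^sub>0 in auto)
qed

end
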